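(* Let $m\ge2$, $n\ge3$. Let $Q_F(m,n)$ be the reduced quiver of the GL$_m$-dimer of a fan triangulation of the convex $n$-gon and $Q'$ the reduced quiver of the GL$_m$-dimer of an arbitrary triangulation of the $n$-gon, with dimer algebras $\Lambda_{Q_F(m,n)}$, $\Lambda_{Q'}$ and sums of boundary idempotents $e_b$, $e_{b'}$. Then there is an algebra isomorphism $$e_b\Lambda_{Q_F(m,n)}e_b\cong e_{b'}\Lambda_{Q'}e_{b'}.$$
   Context: Paths are composed from left to right. The dimer algebra of a dimer model with boundary $Q$ is $\Lambda_Q=\mathbb{C}Q/\langle\partial W\rangle$, where $\partial W$ consists of the relations $p_1\cdots p_k=q_1\cdots q_l$, one for each internal arrow $\alpha$ lying on the anticlockwise face boundary $\alpha p_1\cdots p_k$ and the clockwise face boundary $\alpha q_1\cdots q_l$; boundary vertices are those incident with arrows lying in only one face. A fan triangulation is one whose diagonals all share a common polygon vertex. GL$_m$-dimer and its quiver: let $T$ be a triangulation of a convex $n$-gon $P$. Subdivide every triangle of $T$ by $m-1$ equidistant lines parallel to each of its sides into $m^2$ small triangles (upward ones, i.e. translates of the big triangle, and downward ones). Put a black node at the midpoint of each of the $m$ segments into which each side of each triangle (edge of $P$ or diagonal of $T$) is cut, a black node in every downward small triangle, and a white node in every upward small triangle. Join two nodes of different colour if they belong to the same small triangle or their small triangles share a side. The quiver has one vertex for each connected component of the complement of this graph in $P$ and, for each edge, one arrow between the two components it separates, oriented with the white endpoint on its left; each white node gives an anticlockwise face, each black node of degree $\ge2$ a clockwise face. Every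 2-cycle of internal arrows is removed using the relations from the natural potential (reduced quiver). *)

theory Defs
  imports Complex_Main
begin

text \<open>Polygon vertices are 0,...,n-1 in anticlockwise order. Diagonals and
triangle sides are pairs (i,j) with i<j.\<close>

definition is_edge :: "nat \<Rightarrow> nat \<Rightarrow> nat \<Rightarrow> bool" where
  "is_edge n i j \<longleftrightarrow> i < j \<and> j < n \<and> (j = Suc i \<or> (i = 0 \<and> j = n - 1))"

definition is_diagonal :: "nat \<Rightarrow> nat \<times> nat \<Rightarrow> bool" where
  "is_diagonal n d \<longleftrightarrow> fst d < snd d \<and> snd d < n \<and> \<not> is_edge n (fst d) (snd d)"

definition crosses :: "nat \<times> nat \<Rightarrow> nat \<times> nat \<Rightarrow> bool" where
  "crosses d e \<longleftrightarrow> (fst d < fst e \<and> fst e < snd d \<and> snd d < snd e)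
                  \<or> (fst e < fst d \<and> fst d < snd e \<and> snd e < snd d)"

definition triangulation :: "nat \<Rightarrow> (nat \<times> nat) set \<Rightarrow> bool" where
  "triangulation n T \<longleftrightarrow> (\<forall>d\<in>T. is_diagonal n d) \<and> (\<forall>d\<in>T. \<forall>e\<in>T. \<not> crosses d e)
     \<and> (\<forall>d. is_diagonal n d \<and> d \<notin> T \<longrightarrow> (\<exists>e\<in>T. crosses d e))"

definition fan :: "nat \<Rightarrow> (nat \<times> nat) set \<Rightarrow> bool" where
  "fan n T \<longleftrightarrow> (\<exists>v<n. \<forall>d\<in>T. fst d = v \<or> snd d = v)"

definition is_side :: "nat \<Rightarrow> (nat \<times> nat) set \<Rightarrow> nat \<Rightarrow> nat \<Rightarrow> bool" where
  "is_side n T i j \<longleftrightarrow> is_edge n i j \<or> (i, j) \<in> T"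

text \<open>Triangles (i,j,k), i<j<k, of the triangulation T; i \<rightarrow> j \<rightarrow> k is anticlockwise.\<close>
definition tris :: "nat \<Rightarrow> (nat \<times> nat) set \<Rightarrow> (nat \<times> nat \<times> nat) set" where
  "tris n T = {(i, j, k). i < j \<and> j < k \<and> k < n \<and> is_side n T i j \<and> is_side n T j k \<and> is_side n T i k}"

definition tset :: "nat \<times> nat \<times> nat \<Rightarrow> nat set" where
  "tset t = (case t of (i, j, k) \<Rightarrow> {i, j, k})"

text \<open>Anticlockwise consecutive pairs (x,y) of a triangle together with the third vertex z.\<close>
definition cyc3 :: "nat \<times> nat \<times> nat \<Rightarrow> (nat \<times> nat \<times> nat) set" where
  "cyc3 t = (case t of (i, j, k) \<Rightarrow> {(i, j, k), (j, k, i), (k, i, j)})"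

text \<open>Lattice points of the subdivision are encoded by barycentric weights
  w :: nat \<Rightarrow> nat on the polygon vertices (the point (1/m) \<Sum> w(x) P_x), supported
  on a triangle of T with total weight s.\<close>
definition wt :: "nat \<times> nat \<times> nat \<Rightarrow> nat \<Rightarrow> (nat \<Rightarrow> nat) \<Rightarrow> bool" where
  "wt t s u \<longleftrightarrow> (\<forall>z. z \<notin> tset t \<longrightarrow> u z = 0) \<and> sum u (tset t) = s"

definition pt :: "(nat \<Rightarrow> nat) \<Rightarrow> nat \<Rightarrow> (nat \<Rightarrow> nat)" where
  "pt u x = u(x := Suc (u x))"

type_synonym vtx = "nat \<Rightarrow> nat"
type_synonym arr = "vtx \<times> vtx"   \<comment> \<open>arrow = (source, target)\<close>
type_synonym tri = "(nat \<times> nat \<times> nat) \<times> vtx"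

text \<open>Quiver vertices = faces of the dimer graph = lattice points of the subdivision.\<close>
definition glV :: "nat \<Rightarrow> nat \<Rightarrow> (nat \<times> nat) set \<Rightarrow> vtx set" where
  "glV m n T = {w. \<exists>t\<in>tris n T. wt t m w}"

text \<open>Upward small triangles (t,u) have vertices pt u i, pt u j, pt u k;
  downward small triangles (t,u) have vertices pt (pt u z) x for x \<noteq> z.\<close>
definition ups :: "nat \<Rightarrow> nat \<Rightarrow> (nat \<times> nat) set \<Rightarrow> tri set" where
  "ups m n T = {(t, u). t \<in> tris n T \<and> wt t (m - 1) u}"

definition downs :: "nat \<Rightarrow> nat \<Rightarrow> (nat \<times> nat) set \<Rightarrow> tri set" where
  "downs m n T = {(t, u). t \<in> tris n T \<and> wt t (m - 2) u}"

text \<open>Side segments of upward triangles, oriented anticlockwise (the white node on the left).\<close>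
definition uparrows :: "tri \<Rightarrow> arr set" where
  "uparrows U = {(pt (snd U) x, pt (snd U) y) | x y z. (x, y, z) \<in> cyc3 (fst U)}"

text \<open>Side segments of downward triangles (they are oriented clockwise around it).\<close>
definition darrows :: "tri \<Rightarrow> arr set" where
  "darrows D = {(pt (pt (snd D) z) x, pt (pt (snd D) z) y) | x y z. (x, y, z) \<in> cyc3 (fst D)}"

definition on_diag :: "(nat \<times> nat) set \<Rightarrow> nat \<Rightarrow> nat \<Rightarrow> bool" where
  "on_diag T x y \<longleftrightarrow> (min x y, max x y) \<in> T"

text \<open>Arrows of the reduced quiver: all small segments not lying on a diagonal of T
  (the 2-cycles on the diagonal segments have been removed).\<close>
definition glAr :: "nat \<Rightarrow> nat \<Rightarrow> (nat \<times> nat) set \<Rightarrow> arr set" where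
  "glAr m n T = {(pt u x, pt u y) | t u x y z. (t, u) \<in> ups m n T \<and> (x, y, z) \<in> cyc3 t
                     \<and> \<not> (u z = 0 \<and> on_diag T x y)}"

text \<open>Two upward triangles whose white nodes are joined through a degree-2 black node on
  a diagonal segment; after removing the 2-cycles their white nodes are merged.\<close>
definition up_adj :: "nat \<Rightarrow> nat \<Rightarrow> (nat \<times> nat) set \<Rightarrow> tri \<Rightarrow> tri \<Rightarrow> bool" where
  "up_adj m n T U U' \<longleftrightarrow> U \<in> ups m n T \<and> U' \<in> ups m n T \<and> snd U = snd U' \<and> fst U \<noteq> fst U'
      \<and> card (tset (fst U) \<inter> tset (fst U')) = 2
      \<and> (\<forall>z. snd U z \<noteq> 0 \<longrightarrow> z \<in> tset (fst U) \<inter> tset (fst U'))"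

definition whiteface :: "nat \<Rightarrow> nat \<Rightarrow> (nat \<times> nat) set \<Rightarrow> arr \<Rightarrow> arr set" where
  "whiteface m n T a = {b \<in> glAr m n T. \<exists>U U'. U \<in> ups m n T \<and> a \<in> uparrows U
       \<and> (up_adj m n T)\<^sup>*\<^sup>* U U' \<and> b \<in> uparrows U'}"

text \<open>Clockwise (black, degree \<ge> 2) face containing arrow a.\<close>
definition blackface :: "nat \<Rightarrow> nat \<Rightarrow> (nat \<times> nat) set \<Rightarrow> arr \<Rightarrow> arr set" where
  "blackface m n T a = {b \<in> glAr m n T. \<exists>D \<in> downs m n T. a \<in> darrows D \<and> b \<in> darrows D}"

text \<open>Internal arrows lie in two faces (a white and a black one); the others lie only in
  their white face (they are the segments on the polygon edges).\<close>
definition glInt :: "nat \<Rightarrow> nat \<Rightarrow> (nat \<times> nat) set \<Rightarrow> arr set" where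
  "glInt m n T = {a \<in> glAr m n T. \<exists>D \<in> downs m n T. a \<in> darrows D}"

definition glB :: "nat \<Rightarrow> nat \<Rightarrow> (nat \<times> nat) set \<Rightarrow> vtx set" where
  "glB m n T = {v. \<exists>a \<in> glAr m n T - glInt m n T. fst a = v \<or> snd a = v}"

text \<open>Paths are composed left to right; a path is a start vertex with a list of arrows.\<close>
fun chain :: "'v \<Rightarrow> ('v \<times> 'v) list \<Rightarrow> bool" where
  "chain v [] = True"
| "chain v (a # as) = (fst a = v \<and> chain (snd a) as)"

fun endpt :: "'v \<Rightarrow> ('v \<times> 'v) list \<Rightarrow> 'v" where
  "endpt v [] = v"
| "endpt v (a # as) = endpt (snd a) as"

type_synonym 'v path = "'v \<times> ('v \<times> 'v) list"
type_synonym 'v pel = "'v path \<Rightarrow> complex"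

definition valid_path :: "'v set \<Rightarrow> ('v \<times> 'v) set \<Rightarrow> 'v path \<Rightarrow> bool" where
  "valid_path V A p \<longleftrightarrow> fst p \<in> V \<and> set (snd p) \<subseteq> A \<and> chain (fst p) (snd p)"

definition PA :: "'v set \<Rightarrow> ('v \<times> 'v) set \<Rightarrow> 'v pel set" where
  "PA V A = {x. finite {p. x p \<noteq> 0} \<and> (\<forall>p. x p \<noteq> 0 \<longrightarrow> valid_path V A p)}"

definition padd :: "'v pel \<Rightarrow> 'v pel \<Rightarrow> 'v pel" where
  "padd x y = (\<lambda>p. x p + y p)"

definition psub :: "'v pel \<Rightarrow> 'v pel \<Rightarrow> 'v pel" where
  "psub x y = (\<lambda>p. x p - y p)"

definition psmult :: "complex \<Rightarrow> 'v pel \<Rightarrow> 'v pel" where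
  "psmult c x = (\<lambda>p. c * x p)"

definition pmult :: "'v pel \<Rightarrow> 'v pel \<Rightarrow> 'v pel" where
  "pmult x y = (\<lambda>p. \<Sum>k\<le>length (snd p).
      x (fst p, take k (snd p)) * y (endpt (fst p) (take k (snd p)), drop k (snd p)))"

definition pbasis :: "'v path \<Rightarrow> 'v pel" where
  "pbasis p = (\<lambda>q. if q = p then 1 else 0)"

definition pidem :: "'v set \<Rightarrow> 'v pel" where
  "pidem B = (\<lambda>q. if snd q = [] \<and> fst q \<in> B then 1 else 0)"

inductive_set rel_ideal :: "'v set \<Rightarrow> ('v \<times> 'v) set \<Rightarrow> 'v pel set \<Rightarrow> 'v pel set"
  for V A R where
  gen: "r \<in> R \<Longrightarrow> r \<in> rel_ideal V A R"
| zero: "(\<lambda>_. 0) \<in> rel_ideal V A R"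
| add: "x \<in> rel_ideal V A R \<Longrightarrow> y \<in> rel_ideal V A R \<Longrightarrow> padd x y \<in> rel_ideal V A R"
| smult: "x \<in> rel_ideal V A R \<Longrightarrow> psmult c x \<in> rel_ideal V A R"
| lmult: "x \<in> rel_ideal V A R \<Longrightarrow> a \<in> PA V A \<Longrightarrow> pmult a x \<in> rel_ideal V A R"
| rmult: "x \<in> rel_ideal V A R \<Longrightarrow> a \<in> PA V A \<Longrightarrow> pmult x a \<in> rel_ideal V A R"

text \<open>p is the rest of the face boundary S after the arrow a: a path from the target of a
  to its source using every other arrow of S exactly once (so a p is the face cycle).\<close>
definition face_path :: "('v \<times> 'v) set \<Rightarrow> ('v \<times> 'v) \<Rightarrow> ('v \<times> 'v) list \<Rightarrow> bool" where
  "face_path S a p \<longleftrightarrow> a \<in> S \<and> set p = S - {a} \<and> distinct p \<and> chain (snd a) p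
       \<and> endpt (snd a) p = fst a"

text \<open>The relations \<partial>W of the dimer algebra of the reduced GL_m-dimer.\<close>
definition glR :: "nat \<Rightarrow> nat \<Rightarrow> (nat \<times> nat) set \<Rightarrow> vtx pel set" where
  "glR m n T = {psub (pbasis (snd a, p)) (pbasis (snd a, q)) | a p q.
      a \<in> glInt m n T \<and> face_path (whiteface m n T a) a p \<and> face_path (blackface m n T a) a q}"

text \<open>Representatives of e \<Lambda> e: elements x of CQ with x = e x e.\<close>
definition corner :: "'v set \<Rightarrow> ('v \<times> 'v) set \<Rightarrow> 'v set \<Rightarrow> 'v pel set" where
  "corner V A B = {x \<in> PA V A. pmult (pmult (pidem B) x) (pidem B) = x}"

text \<open>Complex-algebra isomorphism e_1 (CQ_1/I_1) e_1 \<cong> e_2 (CQ_2/I_2) e_2, expressed on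
  representatives: phi induces a well-defined, injective, surjective, C-linear and
  multiplicative map between the quotients.\<close>
definition corner_alg_iso ::
  "'v set \<Rightarrow> ('v \<times> 'v) set \<Rightarrow> 'v pel set \<Rightarrow> 'v set \<Rightarrow>
   'w set \<Rightarrow> ('w \<times> 'w) set \<Rightarrow> 'w pel set \<Rightarrow> 'w set \<Rightarrow> bool" where
  "corner_alg_iso V1 A1 R1 B1 V2 A2 R2 B2 \<longleftrightarrow>
    (\<exists>\<phi>. (\<forall>x\<in>corner V1 A1 B1. \<phi> x \<in> corner V2 A2 B2)
      \<and> (\<forall>x\<in>corner V1 A1 B1. \<forall>y\<in>corner V1 A1 B1.
            psub (\<phi> (padd x y)) (padd (\<phi> x) (\<phi> y)) \<in> rel_ideal V2 A2 R2)
      \<and> (\<forall>x\<in>corner V1 A1 B1. \<forall>c.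
            psub (\<phi> (psmult c x)) (psmult c (\<phi> x)) \<in> rel_ideal V2 A2 R2)
      \<and> (\<forall>x\<in>corner V1 A1 B1. \<forall>y\<in>corner V1 A1 B1.
            psub (\<phi> (pmult x y)) (pmult (\<phi> x) (\<phi> y)) \<in> rel_ideal V2 A2 R2)
      \<and> (\<forall>x\<in>corner V1 A1 B1. x \<in> rel_ideal V1 A1 R1 \<longleftrightarrow> \<phi> x \<in> rel_ideal V2 A2 R2)
      \<and> (\<forall>y\<in>corner V2 A2 B2. \<exists>x\<in>corner V1 A1 B1. psub (\<phi> x) y \<in> rel_ideal V2 A2 R2))"

definition gl_boundary_algs_iso :: "nat \<Rightarrow> nat \<Rightarrow> (nat \<times> nat) set \<Rightarrow> (nat \<times> nat) set \<Rightarrow> bool" where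
  "gl_boundary_algs_iso m n T T' \<longleftrightarrow>
     corner_alg_iso (glV m n T) (glAr m n T) (glR m n T) (glB m n T)
                    (glV m n T') (glAr m n T') (glR m n T') (glB m n T')"

end

theory Submission
  imports Defs
begin

text \<open>
  View a lattice point as a distribution of \<open>m\<close> unit masses on the polygon vertices, supported on a
  triangle. An arrow moves one unit anticlockwise from \<open>x\<close> to \<open>y\<close>; let its degree in \<open>\<nat>\<^sup>n\<close> be the
  indicator of the polygon edges on the arc from \<open>x\<close> to \<open>y\<close>. Every face then has degree
  \<open>(1,\<dots>,1)\<close>, so the relations are homogeneous, and the degree \<open>D\<close> of a path from \<open>v\<close> to \<open>w\<close> is a
  transport plan: \<open>D\<^sub>i - D\<^sub>i\<^sub>-\<^sub>1 = v\<^sub>i - w\<^sub>i\<close>. For any triangulation,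
  \<^item> every such \<open>D \<in> \<nat>\<^sup>n\<close> is the degree of a path from \<open>v\<close> to \<open>w\<close>: some unit can be moved along the
    side of a triangle without exceeding \<open>D\<close>;
  \<^item> two paths with equal ends and equal degree agree modulo the relations, by a diamond argument:
    the relations say that two consecutive moves in one triangle commute, and two different first
    arrows can always be completed to equivalent paths of degree \<open>D\<close>.

  Hence paths modulo relations from \<open>v\<close> to \<open>w\<close> are the transport plans from \<open>v\<close> to \<open>w\<close>, composed by addition.
  This description refers to the triangulation only through the set of lattice points, and the
  boundary lattice points are those on the polygon edges for every triangulation.
\<close>

section \<open>Corner algebras of path algebras with homogeneous relations\<close>

definition pend :: "'v path \<Rightarrow> 'v" where "pend p = endpt (fst p) (snd p)"
definition pcat :: "'v path \<Rightarrow> 'v path \<Rightarrow> 'v path" where "pcat p q = (fst p, snd p @ snd q)"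
definition supp :: "'v pel \<Rightarrow> 'v path set" where "supp x = {p. x p \<noteq> 0}"
text \<open>The linear functional with value \<open>h p\<close> on the basis path \<open>p\<close>.
  Elements are compared through such functionals.\<close>

definition ev :: "('v path \<Rightarrow> complex) \<Rightarrow> 'v pel \<Rightarrow> complex" where
  "ev h x = (\<Sum>p\<in>supp x. x p * h p)"

lemma endpt_append [simp]: "endpt v (P @ Q) = endpt (endpt v P) Q"
  by (induction P arbitrary: v) auto

lemma chain_append [simp]: "chain v (P @ Q) \<longleftrightarrow> chain v P \<and> chain (endpt v P) Q"
  by (induction P arbitrary: v) auto

lemma fst_pcat [simp]: "fst (pcat p q) = fst p" and snd_pcat [simp]: "snd (pcat p q) = snd p @ snd q"
  by (auto simp: pcat_def)

lemma pend_pcat [simp]: "pend p = fst q \<Longrightarrow> pend (pcat p q) = pend q"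
  by (auto simp: pend_def)

lemma ev_cong_set: "finite S \<Longrightarrow> supp x \<subseteq> S \<Longrightarrow> ev h x = (\<Sum>p\<in>S. x p * h p)"
  unfolding ev_def by (rule sum.mono_neutral_left) (auto simp: supp_def)

lemma supp_padd: "supp (padd x y) \<subseteq> supp x \<union> supp y"
  and supp_psub: "supp (psub x y) \<subseteq> supp x \<union> supp y"
  and supp_psmult: "supp (psmult c x) \<subseteq> supp x"
  by (auto simp: supp_def padd_def psub_def psmult_def)

lemma pbasis_self [simp]: "pbasis p p = 1"
  by (simp add: pbasis_def)

lemma supp_pbasis [simp]: "supp (pbasis p) = {p}"
  by (auto simp: supp_def pbasis_def)

lemma finite_supp_padd [simp]: "finite (supp x) \<Longrightarrow> finite (supp y) \<Longrightarrow> finite (supp (padd x y))"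
  and finite_supp_psub [simp]: "finite (supp x) \<Longrightarrow> finite (supp y) \<Longrightarrow> finite (supp (psub x y))"
  and finite_supp_psmult [simp]: "finite (supp x) \<Longrightarrow> finite (supp (psmult c x))"
  by (meson finite_Un finite_subset supp_padd supp_psub supp_psmult)+

lemma ev_padd: "finite (supp x) \<Longrightarrow> finite (supp y) \<Longrightarrow> ev h (padd x y) = ev h x + ev h y"
  using supp_padd[of x y]
  by (simp add: ev_cong_set[of "supp x \<union> supp y"] padd_def sum.distrib algebra_simps)

lemma ev_psub: "finite (supp x) \<Longrightarrow> finite (supp y) \<Longrightarrow> ev h (psub x y) = ev h x - ev h y"
  using supp_psub[of x y]
  by (simp add: ev_cong_set[of "supp x \<union> supp y"] psub_def sum_subtractf algebra_simps)

lemma ev_psmult: "finite (supp x) \<Longrightarrow> ev h (psmult c x) = c * ev h x"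
  using supp_psmult[of c x]
  by (simp add: ev_cong_set[of "supp x"] psmult_def sum_distrib_left algebra_simps)

lemma ev_pbasis [simp]: "ev h (pbasis p) = h p"
  by (simp add: ev_def)

lemma ev_cong: "(\<And>p. x p \<noteq> 0 \<Longrightarrow> h p = h' p) \<Longrightarrow> ev h x = ev h' x"
  unfolding ev_def by (rule sum.cong) (auto simp: supp_def)

lemma supp_pmult: "supp (pmult x y) \<subseteq> {pcat p q | p q. p \<in> supp x \<and> q \<in> supp y \<and> pend p = fst q}"
proof
  fix r assume "r \<in> supp (pmult x y)"
  then obtain k where k: "x (fst r, take k (snd r)) * y (endpt (fst r) (take k (snd r)), drop k (snd r)) \<noteq> 0"
    by (auto simp: supp_def pmult_def elim!: sum.not_neutral_contains_not_neutral)
  have "r = pcat (fst r, take k (snd r)) (endpt (fst r) (take k (snd r)), drop k (snd r))"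
    by (simp add: pcat_def)
  moreover have "(fst r, take k (snd r)) \<in> supp x" "(endpt (fst r) (take k (snd r)), drop k (snd r)) \<in> supp y"
    using k by (auto simp: supp_def)
  ultimately show "r \<in> {pcat p q | p q. p \<in> supp x \<and> q \<in> supp y \<and> pend p = fst q}"
    by (fastforce simp: pend_def)
qed

lemma finite_supp_pmult [simp]:
  assumes "finite (supp x)" "finite (supp y)" shows "finite (supp (pmult x y))"
proof (rule finite_subset)
  show "supp (pmult x y) \<subseteq> (\<lambda>(p, q). pcat p q) ` (supp x \<times> supp y)"
    using supp_pmult[of x y] by (force simp del: split_paired_Ex)
qed (use assms in simp)

text \<open>A path with a cut position is the same as a composable pair of paths, so the convolution
  over cuts turns into a sum over pairs; \<open>F\<close> is this correspondence.\<close>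

lemma ev_pmult:
  assumes "finite (supp x)" "finite (supp y)"
  shows "ev h (pmult x y) =
    (\<Sum>p\<in>supp x. \<Sum>q\<in>supp y. x p * y q * (if pend p = fst q then h (pcat p q) else 0))"
proof -
  define X where "X = {(p, q). p \<in> supp x \<and> q \<in> supp y \<and> pend p = fst q}"
  have "X \<subseteq> supp x \<times> supp y" by (auto simp: X_def)
  then have finX: "finite X" using assms by (meson finite_SigmaI finite_subset)
  define S where "S = (\<lambda>(p, q). pcat p q) ` X"
  have finS: "finite S" using finX by (simp add: S_def)
  have sub: "supp (pmult x y) \<subseteq> S" using supp_pmult[of x y] by (force simp: S_def X_def)
  define Y where "Y = (SIGMA r:S. {..length (snd r)})"
  define F where "F = (\<lambda>(r::'a path, k). ((fst r, take k (snd r)), (endpt (fst r) (take k (snd r)), drop k (snd r))))"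
  have finY: "finite Y" using finS by (auto simp: Y_def)
  have "ev h (pmult x y) = (\<Sum>r\<in>S. pmult x y r * h r)"
    using ev_cong_set[OF finS sub] .
  also have "\<dots> = (\<Sum>(r, k)\<in>Y. x (fst r, take k (snd r)) * y (endpt (fst r) (take k (snd r)), drop k (snd r)) * h r)"
    unfolding Y_def using finS by (subst sum.Sigma[symmetric]) (auto simp: pmult_def sum_distrib_right)
  also have "\<dots> = (\<Sum>(p, q)\<in>F ` Y. x p * y q * h (pcat p q))"
  proof (subst sum.reindex)
    show "inj_on F Y"
    proof (rule inj_onI, clarsimp simp: F_def Y_def)
      fix a b1 b2 and k k' :: nat
      assume h: "k \<le> length b1" "k' \<le> length b2" "take k b1 = take k' b2" "drop k b1 = drop k' b2"
      have "k = k'" using h by (metis length_take min.absorb2)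
      with h show "b1 = b2 \<and> k = k'" by (metis append_take_drop_id)
    qed
  qed (auto simp: F_def pcat_def intro!: sum.cong)
  \<comment> \<open>The image of \<open>Y\<close> under \<open>F\<close> also contains cuts whose
    pieces lie outside the supports; their terms are zero.\<close>
  also have "\<dots> = (\<Sum>(p, q)\<in>X. x p * y q * h (pcat p q))"
  proof (rule sum.mono_neutral_right)
    show "finite (F ` Y)" using finY by simp
    show "X \<subseteq> F ` Y"
    proof clarify
      fix p1 p2 q1 q2 assume pq: "((p1, p2), (q1, q2)) \<in> X"
      then have "(pcat (p1, p2) (q1, q2), length p2) \<in> Y"
        by (force simp: Y_def S_def pcat_def)
      moreover have "F (pcat (p1, p2) (q1, q2), length p2) = ((p1, p2), (q1, q2))"
        using pq by (auto simp: F_def pcat_def X_def pend_def)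
      ultimately show "((p1, p2), (q1, q2)) \<in> F ` Y" by (metis imageI)
    qed
    show "\<forall>i\<in>F ` Y - X. (case i of (p, q) \<Rightarrow> x p * y q * h (pcat p q)) = 0"
      by (force simp: F_def X_def supp_def pend_def)
  qed
  also have "\<dots> = (\<Sum>(p, q)\<in>supp x \<times> supp y. x p * y q * (if pend p = fst q then h (pcat p q) else 0))"
    using assms by (intro sum.mono_neutral_cong_left) (auto simp: X_def split: if_splits)
  also have "\<dots> = (\<Sum>p\<in>supp x. \<Sum>q\<in>supp y. x p * y q * (if pend p = fst q then h (pcat p q) else 0))"
    by (simp add: sum.cartesian_product)
  finally show ?thesis .
qed

text \<open>Coefficients are values of functionals, so an identity between elements can be checked
  with \<open>ev\<close>.\<close>

lemma pel_eq_ev: "finite (supp x) \<Longrightarrow> x r = ev (\<lambda>p. pbasis p r) x"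
  unfolding ev_def pbasis_def by (auto simp: supp_def sum.delta if_distrib[of "(*) _"] cong: if_cong)

lemma pmult_pbasis:
  "pend p = fst q \<Longrightarrow> pmult (pbasis p) (pbasis q) = pbasis (pcat p q)"
  by (rule ext, subst pel_eq_ev, simp, subst ev_pmult) auto

section \<open>Corners, ideals and congruence of paths\<close>

lemma PA_iff: "x \<in> PA V A \<longleftrightarrow> finite (supp x) \<and> (\<forall>p\<in>supp x. valid_path V A p)"
  by (auto simp: PA_def supp_def)

lemma pbasis_in_PA: "valid_path V A p \<Longrightarrow> pbasis p \<in> PA V A"
  by (auto simp: PA_iff)

lemma pidem_left: "pmult (pidem B) x = (\<lambda>p. if fst p \<in> B then x p else 0)"
proof
  fix p :: "'a path"
  have "(\<Sum>k\<le>length (snd p). pidem B (fst p, take k (snd p)) * x (endpt (fst p) (take k (snd p)), drop k (snd p)))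
     = (\<Sum>k\<in>{0}. pidem B (fst p, take k (snd p)) * x (endpt (fst p) (take k (snd p)), drop k (snd p)))"
    by (rule sum.mono_neutral_right) (auto simp: pidem_def)
  then show "pmult (pidem B) x p = (if fst p \<in> B then x p else 0)"
    by (simp add: pmult_def) (simp add: pidem_def)
qed

lemma pidem_right: "pmult x (pidem B) = (\<lambda>p. if pend p \<in> B then x p else 0)"
proof
  fix p :: "'a path"
  have "(\<Sum>k\<le>length (snd p). x (fst p, take k (snd p)) * pidem B (endpt (fst p) (take k (snd p)), drop k (snd p)))
     = (\<Sum>k\<in>{length (snd p)}. x (fst p, take k (snd p)) * pidem B (endpt (fst p) (take k (snd p)), drop k (snd p)))"
    by (rule sum.mono_neutral_right) (auto simp: pidem_def)
  then show "pmult x (pidem B) p = (if pend p \<in> B then x p else 0)"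
    by (simp add: pmult_def) (simp add: pidem_def pend_def)
qed

lemma corner_iff:
  "x \<in> corner V A B \<longleftrightarrow> x \<in> PA V A \<and> (\<forall>p\<in>supp x. fst p \<in> B \<and> pend p \<in> B)"
  unfolding corner_def pidem_left pidem_right by (auto simp: fun_eq_iff supp_def)

lemma valid_path_pcat:
  "valid_path V A p \<Longrightarrow> valid_path V A q \<Longrightarrow> pend p = fst q \<Longrightarrow> valid_path V A (pcat p q)"
  by (auto simp: valid_path_def pend_def)

lemma corner_pmult: "x \<in> corner V A B \<Longrightarrow> y \<in> corner V A B \<Longrightarrow> pmult x y \<in> corner V A B"
proof -
  assume x: "x \<in> corner V A B" and y: "y \<in> corner V A B"
  have "valid_path V A r \<and> fst r \<in> B \<and> pend r \<in> B" if r: "r \<in> supp (pmult x y)" for r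
  proof -
    obtain p q where "r = pcat p q" "p \<in> supp x" "q \<in> supp y" "pend p = fst q"
      using supp_pmult[of x y] r by blast
    then show ?thesis using x y by (simp add: corner_iff PA_iff valid_path_pcat)
  qed
  then show ?thesis using x y by (simp add: corner_iff PA_iff)
qed

lemma corner_psub: "x \<in> corner V A B \<Longrightarrow> y \<in> corner V A B \<Longrightarrow> psub x y \<in> corner V A B"
  using supp_psub[of x y] by (auto simp: corner_iff PA_iff)

lemma rel_ideal_sum:
  assumes "finite S" "\<And>p. p \<in> S \<Longrightarrow> x p \<in> rel_ideal V A R"
  shows "(\<lambda>r. \<Sum>p\<in>S. c p * x p r) \<in> rel_ideal V A R"
  using assms
proof (induction S rule: finite_induct)
  case empty
  then show ?case using rel_ideal.zero by simp
next
  case (insert p S)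
  have "padd (psmult (c p) (x p)) (\<lambda>r. \<Sum>p\<in>S. c p * x p r) \<in> rel_ideal V A R"
    using insert by (intro rel_ideal.add rel_ideal.smult) auto
  then show ?case using insert by (simp add: padd_def psmult_def)
qed

definition pcong :: "'v set \<Rightarrow> ('v \<times> 'v) set \<Rightarrow> 'v pel set \<Rightarrow> 'v path \<Rightarrow> 'v path \<Rightarrow> bool" where
  "pcong V A R p q \<longleftrightarrow> psub (pbasis p) (pbasis q) \<in> rel_ideal V A R"

lemma pcong_refl: "pcong V A R p p"
  using rel_ideal.zero by (simp add: pcong_def psub_def)

lemma pcong_sym: assumes "pcong V A R p q" shows "pcong V A R q p"
proof -
  have "psmult (-1) (psub (pbasis p) (pbasis q)) \<in> rel_ideal V A R"
    using assms unfolding pcong_def by (rule rel_ideal.smult)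
  then show ?thesis by (simp add: pcong_def psub_def psmult_def)
qed

lemma pcong_trans: assumes "pcong V A R p q" "pcong V A R q r" shows "pcong V A R p r"
proof -
  have "padd (psub (pbasis p) (pbasis q)) (psub (pbasis q) (pbasis r)) \<in> rel_ideal V A R"
    using assms unfolding pcong_def by (rule rel_ideal.add)
  then show ?thesis by (simp add: pcong_def psub_def padd_def)
qed

lemma pmult_psub_left: "pmult (psub x y) z = psub (pmult x z) (pmult y z)"
  and pmult_psub_right: "pmult z (psub x y) = psub (pmult z x) (pmult z y)"
  by (auto simp: pmult_def psub_def algebra_simps sum_subtractf)

lemma pcong_left:
  assumes "pcong V A R p q" "valid_path V A r" "pend r = fst p" "pend r = fst q"
  shows "pcong V A R (pcat r p) (pcat r q)"
  using rel_ideal.lmult[OF assms(1)[unfolded pcong_def] pbasis_in_PA[OF assms(2)]] assms(3,4)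
  by (simp add: pcong_def pmult_psub_right pmult_pbasis)

lemma pcong_right:
  assumes "pcong V A R p q" "valid_path V A r" "pend p = fst r" "pend q = fst r"
  shows "pcong V A R (pcat p r) (pcat q r)"
  using rel_ideal.rmult[OF assms(1)[unfolded pcong_def] pbasis_in_PA[OF assms(2)]] assms(3,4)
  by (simp add: pcong_def pmult_psub_left pmult_pbasis)

section \<open>Degrees and keys of paths\<close>

definition degl :: "('a \<Rightarrow> nat \<Rightarrow> nat) \<Rightarrow> 'a list \<Rightarrow> nat \<Rightarrow> nat" where
  "degl d P = (\<lambda>i. \<Sum>a\<leftarrow>P. d a i)"

lemma degl_Nil [simp]: "degl d [] i = 0"
  and degl_Cons [simp]: "degl d (a # P) i = d a i + degl d P i"
  and degl_append [simp]: "degl d (P @ Q) i = degl d P i + degl d Q i"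
  by (auto simp: degl_def)

text \<open>Source, target and degree: the data intended to determine a path modulo the relations.
  Keys compose by \<open>kcat\<close>.\<close>

definition pkey :: "('v \<times> 'v \<Rightarrow> nat \<Rightarrow> nat) \<Rightarrow> 'v path \<Rightarrow> 'v \<times> 'v \<times> (nat \<Rightarrow> nat)" where
  "pkey d p = (fst p, pend p, degl d (snd p))"

definition kcat :: "'v \<times> 'v \<times> (nat \<Rightarrow> nat) \<Rightarrow> 'v \<times> 'v \<times> (nat \<Rightarrow> nat) \<Rightarrow> 'v \<times> 'v \<times> (nat \<Rightarrow> nat)" where
  "kcat k l = (fst k, fst (snd l), (\<lambda>i. snd (snd k) i + snd (snd l) i))"

lemma fst_pkey [simp]: "fst (pkey d p) = fst p" and fst_snd_pkey [simp]: "fst (snd (pkey d p)) = pend p"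
  by (auto simp: pkey_def)

lemma pkey_pcat: "pend p = fst q \<Longrightarrow> pkey d (pcat p q) = kcat (pkey d p) (pkey d q)"
  by (auto simp: pkey_def kcat_def fun_eq_iff)

text \<open>Functionals on the path algebra that only see the key of a path; they vanish on an ideal generated
  by differences of paths with equal keys.\<close>

definition kev :: "('v \<times> 'v \<Rightarrow> nat \<Rightarrow> nat) \<Rightarrow> ('v \<times> 'v \<times> (nat \<Rightarrow> nat) \<Rightarrow> complex) \<Rightarrow> 'v pel \<Rightarrow> complex" where
  "kev d g = ev (\<lambda>p. g (pkey d p))"

text \<open>With \<open>y\<close> fixed, a key functional of the product is again a key functional
  of \<open>x\<close>, because the key of a composite depends on the keys of its parts
  alone.\<close>

lemma kev_pmult_left:
  assumes "finite (supp x)" "finite (supp y)"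
  shows "kev d g (pmult x y) = kev d (\<lambda>k. ev (\<lambda>q. if fst (snd k) = fst q then g (kcat k (pkey d q)) else 0) y) x"
  unfolding kev_def unfolding ev_pmult[OF assms] unfolding ev_def
  by (rule sum.cong) (auto simp: sum_distrib_left pkey_pcat mult_ac intro!: sum.cong)

lemma kev_pmult_right:
  assumes "finite (supp x)" "finite (supp y)"
  shows "kev d g (pmult x y) = kev d (\<lambda>k. ev (\<lambda>p. if pend p = fst k then g (kcat (pkey d p) k) else 0) x) y"
  unfolding kev_def unfolding ev_pmult[OF assms] unfolding ev_def
  by (subst sum.swap, rule sum.cong) (auto simp: sum_distrib_left pkey_pcat mult_ac intro!: sum.cong)

text \<open>The factors are exchanged one at a time, each time regarding the product as a key
  functional of the factor being exchanged.\<close>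

lemma kev_pmult_cong:
  assumes fin: "finite (supp x)" "finite (supp y)" "finite (supp x')" "finite (supp y')"
    and "\<And>g. kev d g x = kev d g x'" "\<And>g. kev d g y = kev d g y'"
  shows "kev d g (pmult x y) = kev d g (pmult x' y')"
  by (simp only: kev_pmult_left[OF fin(1,2)] assms(5) kev_pmult_left[OF fin(3,2), symmetric])
    (simp only: kev_pmult_right[OF fin(3,2)] assms(6) kev_pmult_right[OF fin(3,4), symmetric])

text \<open>Quantifying over all \<open>g\<close> carries the induction: multiplication by a fixed
  element replaces \<open>g\<close> by another function of keys. Finite support is carried along
  because additivity of \<open>ev\<close> relies on it.\<close>

lemma rel_ideal_kev:
  assumes R: "\<And>r. r \<in> R \<Longrightarrow> \<exists>p q. r = psub (pbasis p) (pbasis q) \<and> pkey d p = pkey d q"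
    and "x \<in> rel_ideal V A R"
  shows "finite (supp x) \<and> (\<forall>g. kev d g x = 0)"
  using assms(2)
proof induction
  case (gen r)
  then show ?case using R[OF gen] by (auto simp: kev_def ev_psub)
next
  case zero
  then show ?case by (simp add: kev_def ev_def supp_def)
next
  case (add x y)
  then show ?case by (simp add: kev_def ev_padd)
next
  case (smult x c)
  then show ?case by (simp add: kev_def ev_psmult)
next
  case (lmult x a)
  then show ?case by (auto simp: PA_iff kev_pmult_right)
next
  case (rmult x a)
  then show ?case by (auto simp: PA_iff kev_pmult_left)
qed

section \<open>Comparing two corner algebras through keys\<close>

definition plin :: "('v path \<Rightarrow> 'v path) \<Rightarrow> 'v pel \<Rightarrow> 'v pel" where
  "plin f x = (\<lambda>r. ev (\<lambda>p. pbasis (f p) r) x)"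

lemma plin_padd: "finite (supp x) \<Longrightarrow> finite (supp y) \<Longrightarrow> plin f (padd x y) = padd (plin f x) (plin f y)"
  by (rule ext, simp only: plin_def ev_padd, simp only: padd_def)

lemma plin_psmult: "finite (supp x) \<Longrightarrow> plin f (psmult c x) = psmult c (plin f x)"
  by (rule ext, simp only: plin_def ev_psmult, simp only: psmult_def)

lemma supp_plin: "supp (plin f x) \<subseteq> f ` supp x"
  by (force simp: supp_def plin_def ev_def pbasis_def elim!: sum.not_neutral_contains_not_neutral
      split: if_splits)

lemma ev_plin:
  assumes "finite (supp x)" shows "ev h (plin f x) = ev (\<lambda>p. h (f p)) x"
proof -
  have "ev h (plin f x) = (\<Sum>r\<in>f ` supp x. plin f x r * h r)"
    using assms supp_plin[of f x] by (simp add: ev_cong_set)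
  also have "\<dots> = (\<Sum>r\<in>f ` supp x. \<Sum>p\<in>supp x. x p * pbasis (f p) r * h r)"
    by (simp add: plin_def ev_def sum_distrib_right)
  also have "\<dots> = (\<Sum>p\<in>supp x. \<Sum>r\<in>f ` supp x. x p * pbasis (f p) r * h r)"
    by (rule sum.swap)
  also have "\<dots> = (\<Sum>p\<in>supp x. x p * h (f p))"
  proof (rule sum.cong[OF refl])
    fix p assume p: "p \<in> supp x"
    have "(\<Sum>r\<in>f ` supp x. x p * pbasis (f p) r * h r) = (\<Sum>r\<in>{f p}. x p * pbasis (f p) r * h r)"
      using p assms by (intro sum.mono_neutral_right) (auto simp: pbasis_def)
    then show "(\<Sum>r\<in>f ` supp x. x p * pbasis (f p) r * h r) = x p * h (f p)"
      by (simp add: pbasis_def)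
  qed
  finally show ?thesis by (simp add: ev_def)
qed

text \<open>Subtract from every path of \<open>x\<close> a representative with the same key. The
  differences lie in the ideal, and the coefficients of what is subtracted in total are key
  functionals of \<open>x\<close>, hence zero.\<close>

lemma corner_kev_zero_in_ideal:
  assumes uniq: "\<And>p q. valid_path V A p \<Longrightarrow> valid_path V A q \<Longrightarrow> fst p \<in> B \<Longrightarrow> pend p \<in> B
      \<Longrightarrow> pkey d p = pkey d q \<Longrightarrow> pcong V A R p q"
    and x: "x \<in> corner V A B" and z: "\<And>g. kev d g x = 0"
  shows "x \<in> rel_ideal V A R"
proof -
  have fin: "finite (supp x)" using x by (simp add: corner_iff PA_iff)
  define rep where "rep k = (SOME q. q \<in> supp x \<and> pkey d q = k)" for k
  have rep: "rep (pkey d p) \<in> supp x \<and> pkey d (rep (pkey d p)) = pkey d p" if "p \<in> supp x" for p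
    unfolding rep_def by (rule someI) (use that in auto)
  have "(\<lambda>r. \<Sum>p\<in>supp x. x p * psub (pbasis p) (pbasis (rep (pkey d p))) r) \<in> rel_ideal V A R"
    using fin by (rule rel_ideal_sum, fold pcong_def)
      (use x rep in \<open>auto simp: corner_iff PA_iff intro!: uniq\<close>)
  also have "(\<lambda>r. \<Sum>p\<in>supp x. x p * psub (pbasis p) (pbasis (rep (pkey d p))) r) = x"
  proof
    fix r
    have "(\<Sum>p\<in>supp x. x p * psub (pbasis p) (pbasis (rep (pkey d p))) r)
        = ev (\<lambda>p. pbasis p r) x - kev d (\<lambda>k. pbasis (rep k) r) x"
      by (simp add: ev_def kev_def psub_def algebra_simps sum_subtractf)
    then show "(\<Sum>p\<in>supp x. x p * psub (pbasis p) (pbasis (rep (pkey d p))) r) = x r"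
      using z fin by (simp add: pel_eq_ev[symmetric])
  qed
  finally show ?thesis .
qed

text \<open>On both sides, membership in the ideal is detected by key functionals. A path is sent to
  an arbitrarily chosen path with the same key on the other side; the choice disappears modulo the
  ideal, and with it the failure of strict multiplicativity.\<close>

lemma corner_alg_isoI:
  assumes R1: "\<And>r. r \<in> R1 \<Longrightarrow> \<exists>p q. r = psub (pbasis p) (pbasis q) \<and> pkey d p = pkey d q"
    and R2: "\<And>r. r \<in> R2 \<Longrightarrow> \<exists>p q. r = psub (pbasis p) (pbasis q) \<and> pkey d p = pkey d q"
    and uniq1: "\<And>p q. valid_path V1 A1 p \<Longrightarrow> valid_path V1 A1 q \<Longrightarrow> fst p \<in> B \<Longrightarrow> pend p \<in> B
      \<Longrightarrow> pkey d p = pkey d q \<Longrightarrow> pcong V1 A1 R1 p q"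
    and uniq2: "\<And>p q. valid_path V2 A2 p \<Longrightarrow> valid_path V2 A2 q \<Longrightarrow> fst p \<in> B \<Longrightarrow> pend p \<in> B
      \<Longrightarrow> pkey d p = pkey d q \<Longrightarrow> pcong V2 A2 R2 p q"
    and ex12: "\<And>p. valid_path V1 A1 p \<Longrightarrow> fst p \<in> B \<Longrightarrow> pend p \<in> B
      \<Longrightarrow> \<exists>q. valid_path V2 A2 q \<and> pkey d q = pkey d p"
    and ex21: "\<And>p. valid_path V2 A2 p \<Longrightarrow> fst p \<in> B \<Longrightarrow> pend p \<in> B
      \<Longrightarrow> \<exists>q. valid_path V1 A1 q \<and> pkey d q = pkey d p"
  shows "corner_alg_iso V1 A1 R1 B V2 A2 R2 B"
proof -
  let ?C1 = "corner V1 A1 B" and ?C2 = "corner V2 A2 B"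
  \<comment> \<open>The hypotheses are symmetric in the two algebras, so this construction serves
    for the isomorphism \<open>\<phi>\<close> and for the preimages \<open>\<psi>\<close>.\<close>
  have lift: "\<exists>F. (\<forall>x\<in>corner V A B. F x \<in> corner V' A' B \<and> (\<forall>g. kev d g (F x) = kev d g x))
      \<and> (\<forall>x\<in>corner V A B. \<forall>y\<in>corner V A B. F (padd x y) = padd (F x) (F y))
      \<and> (\<forall>x\<in>corner V A B. \<forall>c. F (psmult c x) = psmult c (F x))"
    if ex: "\<And>p. valid_path V A p \<Longrightarrow> fst p \<in> B \<Longrightarrow> pend p \<in> B
      \<Longrightarrow> \<exists>q. valid_path V' A' q \<and> pkey d q = pkey d p" for V A V' A'
  proof -
    define f where "f p = (SOME q. valid_path V' A' q \<and> pkey d q = pkey d p)" for p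
    have f: "valid_path V' A' (f p) \<and> pkey d (f p) = pkey d p"
      if "valid_path V A p" "fst p \<in> B" "pend p \<in> B" for p
      unfolding f_def by (rule someI_ex) (rule ex[OF that])
    show ?thesis
    proof (intro exI[of _ "plin f"] conjI ballI allI)
      fix x assume x: "x \<in> corner V A B"
      have fx: "valid_path V' A' (f p) \<and> pkey d (f p) = pkey d p" if "p \<in> supp x" for p
        using x that by (intro f) (auto simp: corner_iff PA_iff)
      have "fst (f p) \<in> B \<and> pend (f p) \<in> B" if "p \<in> supp x" for p
        using fx[OF that] x that by (auto simp: corner_iff pkey_def)
      moreover have "finite (supp (plin f x))"
        using x by (meson corner_iff PA_iff finite_imageI finite_subset supp_plin)
      moreover have "\<exists>p\<in>supp x. r = f p" if "r \<in> supp (plin f x)" for r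
        using supp_plin[of f x] that by auto
      ultimately show "plin f x \<in> corner V' A' B"
        using fx unfolding corner_iff PA_iff by metis
      show "kev d g (plin f x) = kev d g x" for g
        unfolding kev_def using x fx by (subst ev_plin) (auto simp: corner_iff PA_iff supp_def intro!: ev_cong)
    next
      fix x y assume "x \<in> corner V A B" "y \<in> corner V A B"
      then show "plin f (padd x y) = padd (plin f x) (plin f y)"
        by (intro plin_padd) (auto simp: corner_iff PA_iff)
    next
      fix x c assume "x \<in> corner V A B"
      then show "plin f (psmult c x) = psmult c (plin f x)"
        by (intro plin_psmult) (auto simp: corner_iff PA_iff)
    qed
  qed
  obtain \<phi> where \<phi>: "\<And>x. x \<in> ?C1 \<Longrightarrow> \<phi> x \<in> ?C2" "\<And>x g. x \<in> ?C1 \<Longrightarrow> kev d g (\<phi> x) = kev d g x"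
      "\<And>x y. x \<in> ?C1 \<Longrightarrow> y \<in> ?C1 \<Longrightarrow> \<phi> (padd x y) = padd (\<phi> x) (\<phi> y)"
      "\<And>x c. x \<in> ?C1 \<Longrightarrow> \<phi> (psmult c x) = psmult c (\<phi> x)"
    using lift[of V1 A1 V2 A2, OF ex12] by blast
  obtain \<psi> where \<psi>: "\<And>x. x \<in> ?C2 \<Longrightarrow> \<psi> x \<in> ?C1" "\<And>x g. x \<in> ?C2 \<Longrightarrow> kev d g (\<psi> x) = kev d g x"
    using lift[of V2 A2 V1 A1, OF ex21] by blast
  have fin: "finite (supp x)" if "x \<in> corner V A B" for x and V :: "'a set" and A
    using that by (simp add: corner_iff PA_iff)
  \<comment> \<open>Equality of all key functionals is congruence modulo the ideal; every remaining
    condition on the target side reduces to this.\<close>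
  have kin2: "psub x y \<in> rel_ideal V2 A2 R2"
    if "x \<in> ?C2" "y \<in> ?C2" "\<And>g. kev d g x = kev d g y" for x y
    using that by (intro corner_kev_zero_in_ideal[OF uniq2]) 
      (auto simp: corner_psub kev_def ev_psub fin)
  have zero2: "psub x x \<in> rel_ideal V2 A2 R2" for x
    using rel_ideal.zero by (simp add: psub_def)
  show ?thesis unfolding corner_alg_iso_def
  proof (intro exI[of _ \<phi>] conjI ballI allI)
    fix x y assume x: "x \<in> ?C1" and y: "y \<in> ?C1"
    show "psub (\<phi> (padd x y)) (padd (\<phi> x) (\<phi> y)) \<in> rel_ideal V2 A2 R2"
      using x y by (simp add: \<phi> zero2)
    show "psub (\<phi> (pmult x y)) (pmult (\<phi> x) (\<phi> y)) \<in> rel_ideal V2 A2 R2"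
    proof (rule kin2)
      show "kev d g (\<phi> (pmult x y)) = kev d g (pmult (\<phi> x) (\<phi> y))" for g
        using kev_pmult_cong[of x y "\<phi> x" "\<phi> y" d g] x y
        by (simp add: \<phi>(1,2) corner_pmult fin[OF x] fin[OF y] fin[OF \<phi>(1)[OF x]] fin[OF \<phi>(1)[OF y]])
    qed (use x y in \<open>auto intro: corner_pmult \<phi>\<close>)
  next
    fix x c assume x: "x \<in> ?C1"
    then show "psub (\<phi> (psmult c x)) (psmult c (\<phi> x)) \<in> rel_ideal V2 A2 R2" by (simp add: \<phi> zero2)
  next
    fix x assume x: "x \<in> ?C1"
    show "x \<in> rel_ideal V1 A1 R1 \<longleftrightarrow> \<phi> x \<in> rel_ideal V2 A2 R2"
    proof
      assume "x \<in> rel_ideal V1 A1 R1"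
      then have k: "\<And>g. kev d g (\<phi> x) = 0" using rel_ideal_kev[OF R1] \<phi>(2)[OF x] by metis
      show "\<phi> x \<in> rel_ideal V2 A2 R2" by (rule corner_kev_zero_in_ideal[OF uniq2 \<phi>(1)[OF x] k])
    next
      assume "\<phi> x \<in> rel_ideal V2 A2 R2"
      then have k: "\<And>g. kev d g x = 0" using rel_ideal_kev[OF R2] \<phi>(2)[OF x] by metis
      show "x \<in> rel_ideal V1 A1 R1" by (rule corner_kev_zero_in_ideal[OF uniq1 x k])
    qed
  next
    fix y assume y: "y \<in> ?C2"
    show "\<exists>x\<in>?C1. psub (\<phi> x) y \<in> rel_ideal V2 A2 R2"
      using y by (intro bexI[of _ "\<psi> y"] kin2) (auto simp: \<phi> \<psi>)
  qed (rule \<phi>)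
qed

section \<open>Triangulations and transport along the polygon\<close>

definition ccw :: "nat \<Rightarrow> nat \<Rightarrow> nat \<Rightarrow> bool" where
  "ccw x y z \<longleftrightarrow> (x < y \<and> y < z) \<or> (y < z \<and> z < x) \<or> (z < x \<and> x < y)"

text \<open>Half-open, because \<open>i\<close> names the polygon edge that starts at
  \<open>i\<close>: the arc from \<open>x\<close> to \<open>y\<close> contains the edge at
  \<open>x\<close> but not the one at \<open>y\<close>. The closed arc \<open>carc\<close> is about
  vertices instead.\<close>

definition inarc :: "nat \<Rightarrow> nat \<Rightarrow> nat \<Rightarrow> bool" where
  "inarc x y i \<longleftrightarrow> i = x \<or> ccw x i y"

definition carc :: "nat \<Rightarrow> nat \<Rightarrow> nat set" where
  "carc x y = {i. i = x \<or> i = y \<or> ccw x i y}"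

lemma ccw_rot: "ccw x y z \<Longrightarrow> ccw y z x"
  by (auto simp: ccw_def)

lemma ccw_not_carc: "ccw x y z \<Longrightarrow> z \<notin> carc x y"
  by (auto simp: ccw_def carc_def)

lemma ccw_cases:
  "ccw p q r \<Longrightarrow> e = p \<or> e = q \<or> e = r \<or> ccw p e q \<or> ccw q e r \<or> ccw r e p"
  unfolding ccw_def
  by (cases e p rule: linorder_cases; cases e q rule: linorder_cases; cases e r rule: linorder_cases;
      elim disjE conjE; simp)

lemma carc_cases: "x \<noteq> y \<Longrightarrow> e \<in> carc x y \<or> ccw y e x"
  unfolding ccw_def carc_def
  by (cases e x rule: linorder_cases; cases e y rule: linorder_cases; cases x y rule: linorder_cases; simp)

lemma carc_Int: "carc p q \<inter> carc q p \<subseteq> {p, q}"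
  by (auto simp: carc_def ccw_def)

lemma ccw_crosses:
  "ccw x a y \<Longrightarrow> ccw y b x \<Longrightarrow> crosses (min x y, max x y) (min a b, max a b)"
  unfolding ccw_def crosses_def
  by (elim disjE conjE; simp add: min_def max_def)

lemma ccw_distinct: "ccw x y z \<Longrightarrow> x \<noteq> y \<and> y \<noteq> z \<and> z \<noteq> x"
  by (auto simp: ccw_def)

lemma ccw_asym: "ccw x y z \<Longrightarrow> \<not> ccw x z y"
  by (auto simp: ccw_def)

text \<open>The number of polygon edges on the anticlockwise arc from \<open>x\<close> to
  \<open>y\<close>, used as an induction measure.\<close>

definition cdist :: "nat \<Rightarrow> nat \<Rightarrow> nat \<Rightarrow> nat" where
  "cdist n x y = (if x \<le> y then y - x else n + y - x)"

lemma cdist_less: "ccw x s y \<Longrightarrow> x < n \<Longrightarrow> s < n \<Longrightarrow> y < n \<Longrightarrow> cdist n x s < cdist n x y"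
  and cdist_less': "ccw x s y \<Longrightarrow> x < n \<Longrightarrow> s < n \<Longrightarrow> y < n \<Longrightarrow> cdist n s y < cdist n x y"
  by (auto simp: ccw_def cdist_def)

section \<open>Sides and triangles of a triangulation\<close>

locale triangulated_polygon =
  fixes n :: nat and T :: "(nat \<times> nat) set"
  assumes n3: "n \<ge> 3" and triang: "triangulation n T"
begin

definition nxt :: "nat \<Rightarrow> nat" where
  "nxt x = (if Suc x = n then 0 else Suc x)"

definition side :: "nat \<Rightarrow> nat \<Rightarrow> bool" where
  "side x y \<longleftrightarrow> is_side n T (min x y) (max x y)"

lemma nxt_less [simp]: "x < n \<Longrightarrow> nxt x < n"
  by (auto simp: nxt_def)

lemma nxt_neq [simp]: "x < n \<Longrightarrow> nxt x \<noteq> x" "x < n \<Longrightarrow> nxt (nxt x) \<noteq> x"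
  using n3 by (auto simp: nxt_def split: if_splits)

lemma ccw_nxt: "x < n \<Longrightarrow> y < n \<Longrightarrow> x \<noteq> y \<Longrightarrow> nxt x \<noteq> y \<Longrightarrow> ccw x (nxt x) y"
  by (auto simp: nxt_def ccw_def)

lemma not_ccw_nxt [simp]: "s < n \<Longrightarrow> \<not> ccw x s (nxt x)"
  by (auto simp: nxt_def ccw_def)

lemma ex_prev:
  assumes "y < n" obtains j where "j < n" "nxt j = y" "\<And>x. x < n \<Longrightarrow> x \<noteq> y \<Longrightarrow> inarc x y j"
proof
  show "(if y = 0 then n - 1 else y - 1) < n" using assms by auto
  show "nxt (if y = 0 then n - 1 else y - 1) = y" using assms by (auto simp: nxt_def)
  show "inarc x y (if y = 0 then n - 1 else y - 1)" if "x < n" "x \<noteq> y" for x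
    using that assms by (auto simp: inarc_def ccw_def)
qed

text \<open>The step knows that the vertex reached is strictly inside the arc, which is where the
  flow estimates assume that no mass sits.\<close>

lemma arc_induct [consumes 4, case_names start step]:
  assumes "x < n" "y < n" "i < n" "inarc x y i" "P x"
    and step: "\<And>j. j < n \<Longrightarrow> inarc x y j \<Longrightarrow> ccw x (nxt j) y \<Longrightarrow> P j \<Longrightarrow> P (nxt j)"
  shows "P i"
  using assms(3,4)
proof (induction "cdist n x i" arbitrary: i rule: less_induct)
  case (less i)
  show ?case
  proof (cases "i = x")
    case False
    then have i: "ccw x i y" using less by (simp add: inarc_def)
    obtain j where j: "j < n" "nxt j = i" "inarc x i j" using ex_prev[of i] less(2) assms(1) False by metis
    have "inarc x y j" using j(3) i by (auto simp: inarc_def ccw_def)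
    moreover have "cdist n x j < cdist n x i"
      using j(3) False cdist_less[of x j i n] assms(1) j(1) less(2)
      by (auto simp: inarc_def cdist_def)
    ultimately have "P j" using less(1) j(1) by blast
    then show ?thesis using step[of j] j i \<open>inarc x y j\<close> by simp
  qed (simp add: assms)
qed

lemma side_sym: "side x y \<longleftrightarrow> side y x"
  by (simp add: side_def min.commute max.commute)

lemma T_diag: "(i, j) \<in> T \<Longrightarrow> i < j \<and> j < n \<and> \<not> is_edge n i j"
  using triang by (fastforce simp: triangulation_def is_diagonal_def)

lemma side_iff: "x < n \<Longrightarrow> y < n \<Longrightarrow> side x y \<longleftrightarrow> y = nxt x \<or> x = nxt y \<or> on_diag T x y"
  using n3 by (auto simp: side_def is_side_def is_edge_def on_diag_def nxt_def min_def max_def split: if_splits)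

lemma on_diag_iff: "ccw x y z \<Longrightarrow> x < n \<Longrightarrow> y < n \<Longrightarrow> z < n \<Longrightarrow> side x y \<Longrightarrow> on_diag T x y \<longleftrightarrow> y \<noteq> nxt x"
proof -
  assume a: "ccw x y z" "x < n" "y < n" "z < n" "side x y"
  have "x \<noteq> nxt y" using a not_ccw_nxt[of z y] ccw_rot by blast
  moreover have "\<not> on_diag T x (nxt x)"
    using T_diag[of "min x (nxt x)" "max x (nxt x)"] a(2) n3
    by (auto simp: on_diag_def is_edge_def nxt_def min_def max_def split: if_splits)
  ultimately show ?thesis using a side_iff[of x y] by auto
qed

lemma side_less: "side x y \<Longrightarrow> x < n \<and> y < n \<and> x \<noteq> y"
  using T_diag[of "min x y" "max x y"]
  by (auto simp: side_def is_side_def is_edge_def min_def max_def split: if_splits)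

lemma sides_not_cross:
  assumes "is_side n T i j" "is_side n T k l" shows "\<not> crosses (i, j) (k, l)"
proof (cases "(i, j) \<in> T \<and> (k, l) \<in> T")
  case True
  then show ?thesis using triang by (simp add: triangulation_def)
next
  case False
  then show ?thesis using assms T_diag[of i j] T_diag[of k l]
    by (auto simp: is_side_def is_edge_def crosses_def)
qed

lemma side_not_cross: "side x y \<Longrightarrow> side a b \<Longrightarrow> ccw x a y \<Longrightarrow> b \<in> carc x y"
proof -
  assume a: "side x y" "side a b" "ccw x a y"
  have "\<not> crosses (min x y, max x y) (min a b, max a b)"
    using sides_not_cross a(1,2) by (simp add: side_def)
  then have "\<not> ccw y b x" using ccw_crosses[OF a(3)] by blast
  moreover have "x \<noteq> y" using side_less a by blast
  ultimately show ?thesis using carc_cases by blast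
qed

text \<open>Among the vertices on the arc joined to \<open>x\<close> by a side, take the farthest,
  \<open>s\<close>. If \<open>s y\<close> were not a side, maximality of the triangulation gives a
  side crossing it. That side cannot cross \<open>x y\<close>, so it starts at \<open>x\<close>,
  against the choice of \<open>s\<close>, or strictly between \<open>x\<close> and \<open>s\<close>,
  and then it crosses \<open>x s\<close>.\<close>

lemma ex_opp:
  assumes "side x y" "y \<noteq> nxt x" obtains s where "ccw x s y" "side x s" "side s y"
proof -
  have xy: "x < n" "y < n" "x \<noteq> y" using side_less[OF assms(1)] by auto
  define S where "S = {s. ccw x s y \<and> side x s}"
  have "S \<subseteq> {..<n}" using side_less by (auto simp: S_def)
  then have finS: "finite S" by (rule finite_subset) simp
  have "nxt x \<in> S" using xy assms ccw_nxt[of x y] side_iff[of x "nxt x"] by (auto simp: S_def)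
  then have "Max (cdist n x ` S) \<in> cdist n x ` S" using finS by (intro Max_in) auto
  then obtain s where s: "s \<in> S" "cdist n x s = Max (cdist n x ` S)" by auto
  have smax: "cdist n x c \<le> cdist n x s" if "c \<in> S" for c
    using that finS s(2) by simp
  have s1: "ccw x s y" "side x s" "s < n" using s(1) side_less by (auto simp: S_def)
  have "side s y"
  proof (rule ccontr)
    assume nsd: "\<not> side s y"
    have "is_diagonal n (min s y, max s y)" "(min s y, max s y) \<notin> T"
      using nsd s1 xy ccw_distinct[OF s1(1)] by (auto simp: is_diagonal_def side_def is_side_def min_def max_def)
    then have "\<exists>e\<in>T. crosses (min s y, max s y) e"
      using triang by (simp add: triangulation_def)
    then obtain a b where ab: "(a, b) \<in> T" "crosses (min s y, max s y) (a, b)" by auto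
    have sdab: "side a b" using ab(1) T_diag[OF ab(1)] by (simp add: side_def is_side_def)
    have "(ccw s a y \<and> ccw y b s) \<or> (ccw s b y \<and> ccw y a s)"
      using ab(2) T_diag[OF ab(1)] by (auto simp: crosses_def ccw_def min_def max_def split: if_splits)
    then obtain c d where cd: "side c d" "ccw s c y" "ccw y d s"
      using sdab side_sym by blast
    have "ccw x c y" using cd(2) s1(1) by (auto simp: ccw_def)
    then have "d \<in> carc x y" using side_not_cross[OF assms(1) cd(1)] by simp
    then have "d = x \<or> ccw x d s" using cd(3) s1(1) by (auto simp: carc_def ccw_def)
    then show False
    proof
      assume "d = x"
      then have "c \<in> S" using cd \<open>ccw x c y\<close> side_sym by (auto simp: S_def)
      moreover have "cdist n x s < cdist n x c"
        using cd s1 side_less[OF cd(1)] xy by (intro cdist_less) (auto simp: ccw_def)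
      ultimately show False using smax by force
    next
      assume "ccw x d s"
      then have "c \<in> carc x s" using side_not_cross[OF s1(2), of d c] cd(1) side_sym by blast
      then show False using cd(2) s1(1) by (auto simp: carc_def ccw_def)
    qed
  qed
  then show ?thesis using that s1 by blast
qed

text \<open>A triangle of \<open>T\<close> read anticlockwise from any of its vertices, where
  \<open>tris\<close> lists the vertices by size. Arguments can thus be rotated.\<close>

definition otri :: "nat \<Rightarrow> nat \<Rightarrow> nat \<Rightarrow> bool" where
  "otri x y z \<longleftrightarrow> ccw x y z \<and> side x y \<and> side y z \<and> side z x"

lemma otri_rot: "otri x y z \<Longrightarrow> otri y z x"
  by (auto simp: otri_def ccw_rot)

lemma otri_rot': "otri x y z \<Longrightarrow> otri z x y"
  by (auto simp: otri_def ccw_rot)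

lemma otri_less: "otri x y z \<Longrightarrow> x < n \<and> y < n \<and> z < n"
  by (auto simp: otri_def side_less)

lemma otri_distinct: "otri x y z \<Longrightarrow> x \<noteq> y \<and> y \<noteq> z \<and> z \<noteq> x \<and> y \<noteq> x \<and> z \<noteq> y \<and> x \<noteq> z"
  by (auto simp: otri_def ccw_def)

lemma otri_not_swap: "otri x y z \<Longrightarrow> \<not> otri y x z"
  by (auto simp: otri_def ccw_def)

lemma otri_ex_opp:
  assumes "otri x y z" "y \<noteq> nxt x" obtains s where "otri x s y"
  using assms ex_opp[of x y] by (metis otri_def side_sym)

text \<open>Read backwards, the polygon edge is a side whose arc runs round the rest of the polygon,
  so \<open>ex_opp\<close> applies to it.\<close>

lemma otri_ex_edge:
  assumes "x < n" obtains z where "otri x (nxt x) z"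
proof -
  have "side (nxt x) x" using assms side_iff[of "nxt x" x] by auto
  moreover have "x \<noteq> nxt (nxt x)" using assms nxt_neq(2)[of x] by metis
  ultimately obtain s where "ccw (nxt x) s x" "side (nxt x) s" "side s x" using ex_opp by blast
  then show ?thesis using that[of s] assms side_iff[of x "nxt x"] ccw_rot
    by (auto simp: otri_def)
qed

text \<open>Sides do not cross: once a vertex of the second triangle is strictly inside an arc cut
  off by the first, its sides keep the other two vertices in that closed arc. If there is no such
  vertex, the vertex sets agree.\<close>

lemma otri_position:
  assumes pqr: "otri p q r" and abc: "otri a b c"
  shows "{a, b, c} = {p, q, r} \<or> {a, b, c} \<subseteq> carc p q \<or> {a, b, c} \<subseteq> carc q r \<or> {a, b, c} \<subseteq> carc r p"
proof -
  have in1: "{a, b, c} \<subseteq> carc x y"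
    if "side x y" "e \<in> {a, b, c}" "ccw x e y" for x y e
  proof -
    have "f \<in> carc x y" if "f \<in> {a, b, c}" for f
    proof (cases "f = e")
      case True
      then show ?thesis using \<open>ccw x e y\<close> by (simp add: carc_def)
    next
      case False
      then have "side e f" using that \<open>e \<in> {a, b, c}\<close> abc by (auto simp: otri_def side_sym)
      then show ?thesis using side_not_cross \<open>side x y\<close> \<open>ccw x e y\<close> by blast
    qed
    then show ?thesis by blast
  qed
  have "e \<in> {p, q, r} \<or> ccw p e q \<or> ccw q e r \<or> ccw r e p" for e
    using ccw_cases[of p q r e] pqr by (auto simp: otri_def)
  then consider "\<forall>e\<in>{a, b, c}. e \<in> {p, q, r}" | e where "e \<in> {a, b, c}" "ccw p e q \<or> ccw q e r \<or> ccw r e p"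
    by metis
  then show ?thesis
  proof cases
    case 1
    then have "{a, b, c} \<subseteq> {p, q, r}" by blast
    moreover have "card {a, b, c} = card {p, q, r}"
      using otri_distinct[OF abc] otri_distinct[OF pqr] by simp
    ultimately show ?thesis using card_subset_eq[of "{p, q, r}" "{a, b, c}"] by simp
  next
    case 2
    then show ?thesis using in1 pqr unfolding otri_def by metis
  qed
qed

text \<open>The closed arcs \<open>carc x y\<close>, \<open>carc y z\<close> and
  \<open>carc z x\<close> miss \<open>z'\<close>, \<open>x\<close> and \<open>y\<close>
  respectively, so \<open>otri_position\<close> leaves equality of the vertex sets.\<close>

lemma otri_third: "otri x y z \<Longrightarrow> otri x y z' \<Longrightarrow> z = z'"
proof -
  assume t: "otri x y z" "otri x y z'"
  have "z' \<notin> carc x y" "x \<notin> carc y z" "y \<notin> carc z x"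
    using t ccw_not_carc ccw_rot unfolding otri_def by metis+
  then have "{x, y, z'} = {x, y, z}" using otri_position[OF t] by blast
  then show "z = z'" using otri_distinct[OF t(1)] by blast
qed

section \<open>Transport plans around the polygon\<close>

text \<open>\<open>D j\<close> units of mass cross the polygon edge from \<open>j\<close> to \<open>j + 1\<close> while the distribution \<open>v\<close> is
  transported anticlockwise to \<open>w\<close>.\<close>

definition flow :: "(nat \<Rightarrow> nat) \<Rightarrow> (nat \<Rightarrow> nat) \<Rightarrow> (nat \<Rightarrow> nat) \<Rightarrow> bool" where
  "flow v D w \<longleftrightarrow> (\<forall>j<n. D (nxt j) + w (nxt j) = D j + v (nxt j))"

text \<open>Where nothing is absorbed, whatever crosses an edge also crosses the next one.\<close>

lemma flow_mono:
  assumes "flow v D w" "x < n" "y < n" "i < n" "inarc x y i"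
    and "\<And>j. ccw x j y \<Longrightarrow> w j = 0"
  shows "D x \<le> D i"
  using assms(2-5)
proof (induction rule: arc_induct)
  case (step j)
  have "D (nxt j) + w (nxt j) = D j + v (nxt j)" using assms(1) step(1) by (simp add: flow_def)
  then show ?case using step(4) assms(6)[OF step(3)] by simp
qed simp

lemma flow_const:
  assumes "flow v D w" "x < n" "y < n" "i < n" "inarc x y i"
    and "\<And>j. ccw x j y \<Longrightarrow> w j = 0 \<and> v j = 0"
  shows "D i = D x"
  using assms(2-5)
proof (induction rule: arc_induct)
  case (step j)
  have "D (nxt j) + w (nxt j) = D j + v (nxt j)" using assms(1) step(1) by (simp add: flow_def)
  then show ?case using step(4) assms(6)[OF step(3)] by simp
qed simp

text \<open>An arc with no mass strictly inside behaves like a single polygon edge.\<close>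

lemma flow_arc:
  assumes "flow v D w" "x < n" "y < n" "x \<noteq> y"
    and "\<And>j. ccw x j y \<Longrightarrow> w j = 0 \<and> v j = 0"
  shows "D y + w y = D x + v y"
proof -
  obtain j where j: "j < n" "nxt j = y" "inarc x y j" using ex_prev assms by metis
  have "D j = D x" using flow_const[OF assms(1,2,3) j(1,3) assms(5)] .
  then show ?thesis using assms(1) j by (force simp: flow_def)
qed

text \<open>The mass starting at \<open>x\<close> may not stay there, so it crosses the edge at
  \<open>x\<close> and travels on until something can absorb it.\<close>

lemma flow_outflow:
  assumes "flow v D w" "x < n" "y < n" "i < n" "inarc x y i" "v x > 0" "w x = 0"
    and "\<And>j. ccw x j y \<Longrightarrow> w j = 0"
  shows "D i > 0"
proof -
  obtain j where "j < n" "nxt j = x" using ex_prev assms(2) by metis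
  then have "D x > 0" using assms(1,6,7) unfolding flow_def by (metis add_eq_0_iff_both_eq_0 gr0I not_gr0)
  then show ?thesis using flow_mono[OF assms(1-5,8)] by linarith
qed

text \<open>Two plans with the same ends differ by a constant, so agreement at one edge
  decides.\<close>

lemma flow_unique:
  assumes "flow v D w" "flow v D' w" "k < n" "D k = D' k" "i < n"
  shows "D i = D' i"
proof (cases "i = k")
  case False
  obtain j where j: "j < n" "nxt j = k" using ex_prev assms(3) by metis
  \<comment> \<open>The half-open arc from \<open>k\<close> to its predecessor \<open>j\<close>
    covers every edge except \<open>j\<close>, which is treated separately.\<close>
  have "i = j \<or> inarc k j i" using False j assms by (auto simp: inarc_def ccw_def nxt_def split: if_splits)
  then show ?thesis
  proof
    assume "inarc k j i"
    with assms(3) j(1) assms(5) show ?thesis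
    proof (induction rule: arc_induct)
      case (step j)
      have "D (nxt j) + w (nxt j) = D j + v (nxt j)" "D' (nxt j) + w (nxt j) = D' j + v (nxt j)"
        using assms(1,2) step(1) by (simp_all add: flow_def)
      then show ?case using step(4) by simp
    qed (fact assms(4))
  next
    assume "i = j"
    moreover have "D k + w k = D j + v k" "D' k + w k = D' j + v k"
      using assms(1,2) j by (auto simp: flow_def)
    ultimately show ?thesis using assms(4) by simp
  qed
qed (use assms in simp)

section \<open>A first move that fits into a given plan\<close>

definition wgt :: "nat \<Rightarrow> (nat \<Rightarrow> nat) \<Rightarrow> nat \<Rightarrow> nat \<Rightarrow> nat \<Rightarrow> bool" where
  "wgt s u x y z \<longleftrightarrow> (\<forall>i. i \<noteq> x \<and> i \<noteq> y \<and> i \<noteq> z \<longrightarrow> u i = 0) \<and> u x + u y + u z = s"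

lemma wgt_rot: "wgt s u x y z \<Longrightarrow> wgt s u y z x"
  by (auto simp: wgt_def)

text \<open>The plan is constant on each of the three arcs. If an arc carries flow but its start has
  no mass, the preceding arc carries flow as well; going backwards, a vertex with mass is reached,
  since the total mass is positive.\<close>

lemma ex_move_same:
  assumes t: "otri p q r" and v: "wgt s v p q r" "s > 0"
    and w: "\<And>j. j \<notin> {p, q, r} \<Longrightarrow> w j = 0"
    and fl: "flow v D w" and nz: "i < n" "D i > 0"
  shows "\<exists>x y z. otri x y z \<and> wgt s v x y z \<and> v x > 0 \<and> (\<forall>i<n. inarc x y i \<longrightarrow> D i > 0)"
proof -
  note less = otri_less[OF t] and dis = otri_distinct[OF t]
  have zero: "w j = 0 \<and> v j = 0" if "j \<notin> {p, q, r}" for j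
    using that v(1) w by (auto simp: wgt_def)
  have out: "ccw p j q \<Longrightarrow> j \<notin> {p, q, r}" "ccw q j r \<Longrightarrow> j \<notin> {p, q, r}" "ccw r j p \<Longrightarrow> j \<notin> {p, q, r}" for j
    using t by (auto simp: otri_def ccw_def)
  have c: "i < n \<Longrightarrow> inarc p q i \<Longrightarrow> D i = D p" "i < n \<Longrightarrow> inarc q r i \<Longrightarrow> D i = D q"
    "i < n \<Longrightarrow> inarc r p i \<Longrightarrow> D i = D r" for i
    by (rule flow_const[OF fl]; use less zero out in blast)+
  have e: "D q + w q = D p + v q" "D r + w r = D q + v r" "D p + w p = D r + v p"
    by (rule flow_arc[OF fl]; use less dis zero out in blast)+
  have "inarc p q i \<or> inarc q r i \<or> inarc r p i"
    using ccw_cases[of p q r i] t by (auto simp: otri_def inarc_def)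
  then have "D p > 0 \<or> D q > 0 \<or> D r > 0" using c[OF nz(1)] nz(2) by metis
  moreover have "v p + v q + v r > 0" using v by (simp add: wgt_def)
  ultimately have "(v p > 0 \<and> D p > 0) \<or> (v q > 0 \<and> D q > 0) \<or> (v r > 0 \<and> D r > 0)"
    using e by linarith
  then show ?thesis
    using t v(1) c otri_rot wgt_rot by metis
qed

text \<open>The triangle of \<open>w\<close> lies behind the side \<open>p q\<close>. Mass at \<open>r\<close> has to leave through the arc
  from \<open>r\<close> to \<open>p\<close>; without such mass, \<open>v\<close> also lives on the triangle across \<open>p q\<close>, which is closer to
  that of \<open>w\<close>.\<close>

lemma ex_move_arc:
  assumes "otri p q r" "wgt s v p q r" "s > 0" "otri a b c" "{a, b, c} \<subseteq> carc p q"
    and w: "\<And>j. j \<notin> {a, b, c} \<Longrightarrow> w j = 0"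
    and fl: "flow v D w" and nz: "i < n" "D i > 0"
  shows "\<exists>x y z. otri x y z \<and> wgt s v x y z \<and> v x > 0 \<and> (\<forall>i<n. inarc x y i \<longrightarrow> D i > 0)"
  using assms(1,2,5)
proof (induction "cdist n p q" arbitrary: p q r rule: less_induct)
  case (less p q r)
  note t = less(2) note lt = otri_less[OF t]
  have qp: "w j = 0" if "ccw q j p" for j
    using that less(4) ccw_not_carc[OF ccw_rot[OF ccw_rot[OF that]]] by (intro w) blast
  show ?case
  proof (cases "v r > 0")
    case True
    have "\<forall>i<n. inarc r p i \<longrightarrow> D i > 0"
      using lt True t qp
      by (intro allI impI flow_outflow[OF fl, of r p]) (auto simp: otri_def ccw_def)
    then show ?thesis using True t less(3) otri_rot wgt_rot by metis
  next
    case False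
    have "q \<noteq> nxt p"
    proof
      assume "q = nxt p"
      then have "{a, b, c} \<subseteq> {p, q}" using less(4) lt not_ccw_nxt otri_less[OF assms(4)] by (auto simp: carc_def)
      then show False using otri_distinct[OF assms(4)] by auto
    qed
    then obtain k where k: "otri p k q" using otri_ex_opp t by metis
    have wk: "wgt s v p k q" using less(3) False otri_distinct[OF k] otri_distinct[OF t]
      by (auto simp: wgt_def)
    have cd: "cdist n p k < cdist n p q" "cdist n k q < cdist n p q"
      using k otri_less[OF k] by (auto simp: otri_def intro: cdist_less cdist_less')
    consider "{a, b, c} = {p, k, q}" | "{a, b, c} \<subseteq> carc p k" | "{a, b, c} \<subseteq> carc k q" | "{a, b, c} \<subseteq> carc q p"
      using otri_position[OF k assms(4)] by blast
    then show ?thesis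
    proof cases
      case 1
      then show ?thesis using w by (intro ex_move_same[OF k wk assms(3) _ fl nz]) auto
    next
      case 2
      then show ?thesis using less(1)[OF cd(1) k wk] by blast
    next
      case 3
      then show ?thesis using less(1)[OF cd(2) otri_rot[OF k] wgt_rot[OF wk]] by blast
    next
      case 4
      \<comment> \<open>Opposite closed arcs share just \<open>p\<close> and \<open>q\<close>, too
        few points for a triangle.\<close>
      then have "{a, b, c} \<subseteq> {p, q}" using less(4) carc_Int by blast
      then have "card {a, b, c} \<le> card {p, q}" by (intro card_mono) auto
      then show ?thesis using otri_distinct[OF assms(4)] by (auto split: if_splits simp: card_insert_if)
    qed
  qed
qed

text \<open>The triangle of \<open>w\<close> equals that of \<open>v\<close> or lies behind one of
  its sides. Up to rotation these are the two situations already treated.\<close>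

lemma ex_move:
  assumes pqr: "otri p q r" "wgt s v p q r" and "s > 0" and abc: "otri a b c"
    and w: "\<And>j. j \<notin> {a, b, c} \<Longrightarrow> w j = 0"
    and fl: "flow v D w" and nz: "i < n" "D i > 0"
  obtains x y z where "otri x y z" "wgt s v x y z" "v x > 0" "\<forall>i<n. inarc x y i \<longrightarrow> D i > 0"
proof -
  note arc = ex_move_arc[OF _ _ assms(3) abc _ w fl nz]
  consider "{a, b, c} = {p, q, r}" | "{a, b, c} \<subseteq> carc p q" | "{a, b, c} \<subseteq> carc q r" | "{a, b, c} \<subseteq> carc r p"
    using otri_position[OF pqr(1) abc] by blast
  then have "\<exists>x y z. otri x y z \<and> wgt s v x y z \<and> v x > 0 \<and> (\<forall>i<n. inarc x y i \<longrightarrow> D i > 0)"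
  proof cases
    case 1
    then show ?thesis using w by (intro ex_move_same[OF pqr assms(3) _ fl nz]) auto
  next
    case 2
    then show ?thesis using arc pqr by blast
  next
    case 3
    then show ?thesis using arc[OF otri_rot[OF pqr(1)] wgt_rot[OF pqr(2)]] by blast
  next
    case 4
    then show ?thesis using arc[OF otri_rot[OF otri_rot[OF pqr(1)]] wgt_rot[OF wgt_rot[OF pqr(2)]]] by blast
  qed
  then show ?thesis using that by blast
qed

end

section \<open>Paths in the dimer quiver\<close>

definition ar :: "vtx \<Rightarrow> nat \<Rightarrow> nat \<Rightarrow> arr" where
  "ar u x y = (pt u x, pt u y)"

text \<open>Passes from an anticlockwise triple to the sorted one used by \<open>tris\<close>; the
  last branch is meant for \<open>z < x < y\<close>.\<close>

definition sorted_triple :: "nat \<Rightarrow> nat \<Rightarrow> nat \<Rightarrow> nat \<times> nat \<times> nat" where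
  "sorted_triple x y z = (if x < y \<and> y < z then (x, y, z) else if y < z \<and> z < x then (y, z, x) else (z, x, y))"

text \<open>The polygon edges from \<open>i\<close> to \<open>i + 1\<close> that a unit of mass passes when it moves along the arrow,
  i.e. those of the anticlockwise arc from \<open>x\<close> to \<open>y\<close> for the arrow \<open>ar u x y\<close>.\<close>

definition arrow_deg :: "nat \<Rightarrow> arr \<Rightarrow> nat \<Rightarrow> nat" where
  "arrow_deg n a i = (if i < n \<and> (\<exists>x y. snd a x < fst a x \<and> fst a y < snd a y \<and> inarc x y i) then 1 else 0)"

definition arcdeg :: "nat \<Rightarrow> nat \<Rightarrow> nat \<Rightarrow> nat \<Rightarrow> nat" where
  "arcdeg n x y i = (if i < n \<and> inarc x y i then 1 else 0)"

lemma fst_ar [simp]: "fst (ar u x y) = pt u x" and snd_ar [simp]: "snd (ar u x y) = pt u y"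
  by (auto simp: ar_def)

lemma pt_apply: "pt u x i = (if i = x then Suc (u x) else u i)"
  by (simp add: pt_def)

lemma pt_inj: "pt u x = pt u' x \<Longrightarrow> u = u'"
  by (auto simp: pt_apply fun_eq_iff split: if_splits)

lemma pt_commute: "pt (pt u x) y = pt (pt u y) x"
  by (auto simp: pt_apply fun_eq_iff)

lemma ex_pt: "v x > 0 \<Longrightarrow> \<exists>u. v = pt u x"
  by (rule exI[of _ "v(x := v x - 1)"]) (auto simp: pt_apply fun_eq_iff)

text \<open>Along an arrow exactly \<open>x\<close> loses and exactly \<open>y\<close> gains mass,
  so the ends determine the direction and the base point.\<close>

lemma ar_inj:
  assumes "ar u x y = ar u' x' y'" "x \<noteq> y" "x' \<noteq> y'" shows "u = u' \<and> x = x' \<and> y = y'"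
proof -
  have e: "pt u x i = pt u' x' i" "pt u y i = pt u' y' i" for i using assms(1) by (auto simp: ar_def)
  have "x = x'" using e[of x] e[of x'] assms(2,3) by (auto simp: pt_apply split: if_splits)
  moreover have "y = y'" using e[of y] e[of y'] assms(2,3) by (auto simp: pt_apply split: if_splits)
  ultimately show ?thesis using assms(1) pt_inj by (auto simp: ar_def)
qed

lemma arrow_deg_ar: "x \<noteq> y \<Longrightarrow> arrow_deg n (ar u x y) = arcdeg n x y"
proof
  fix i assume "x \<noteq> y"
  then have "(\<exists>x' y'. pt u y x' < pt u x x' \<and> pt u x y' < pt u y y' \<and> inarc x' y' i) \<longleftrightarrow> inarc x y i"
    by (auto simp: pt_apply split: if_splits)
  then show "arrow_deg n (ar u x y) i = arcdeg n x y i" by (simp add: arrow_deg_def arcdeg_def)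
qed

lemma degl_arrow_deg_ge: "i \<ge> n \<Longrightarrow> degl (arrow_deg n) P i = 0"
  by (induction P) (auto simp: arrow_deg_def)

lemma inarc_self [simp]: "inarc x y x"
  by (simp add: inarc_def)

lemma inarc_split:
  "ccw x s y \<Longrightarrow> (inarc x y i \<longleftrightarrow> inarc x s i \<or> inarc s y i) \<and> \<not> (inarc x s i \<and> inarc s y i)"
  unfolding ccw_def inarc_def
  by (cases i x rule: linorder_cases; cases i s rule: linorder_cases; cases i y rule: linorder_cases;
      elim disjE conjE; simp)

lemma inarc_compl: "x \<noteq> z \<Longrightarrow> inarc x z i \<longleftrightarrow> \<not> inarc z x i"
  unfolding ccw_def inarc_def
  by (cases i x rule: linorder_cases; cases i z rule: linorder_cases; cases x z rule: linorder_cases; simp)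

lemma arcdeg_split: "ccw x s y \<Longrightarrow> arcdeg n x s i + arcdeg n s y i = arcdeg n x y i"
  using inarc_split[of x s y i] by (auto simp: arcdeg_def)

text \<open>The three arcs of an anticlockwise triple partition the polygon edges. Homogeneity of
  the relations rests on this.\<close>

lemma arcdeg_cycle:
  assumes "ccw x y z" "i < n" shows "arcdeg n x y i + arcdeg n y z i + arcdeg n z x i = 1"
proof -
  have "arcdeg n x z i + arcdeg n z x i = 1"
    using assms(2) inarc_compl[of x z i] ccw_distinct[OF assms(1)] by (auto simp: arcdeg_def)
  then show ?thesis using arcdeg_split[OF assms(1)] by simp
qed

text \<open>A repeated arrow would be counted twice at an edge where its own degree is
  positive.\<close>

lemma distinct_if_degl:
  "(\<And>i. degl d P i \<le> 1) \<Longrightarrow> (\<And>a. a \<in> set P \<Longrightarrow> \<exists>i. d a i > 0) \<Longrightarrow> distinct P"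
proof (induction P)
  case (Cons a P)
  have "degl d P i \<le> 1" for i using Cons.prems(1)[of i] by simp
  moreover have "a \<notin> set P"
  proof
    assume "a \<in> set P"
    obtain i where "d a i > 0" using Cons.prems(2) by auto
    moreover have "d a i \<le> degl d P i" using \<open>a \<in> set P\<close> by (induction P) auto
    ultimately show False using Cons.prems(1)[of i] by simp
  qed
  ultimately show ?case using Cons by simp
qed simp

lemma degl_pos: "degl d P i > 0 \<Longrightarrow> \<exists>a\<in>set P. d a i > 0"
  by (induction P) auto

lemma degl_zero_iff: "degl d P i = 0 \<longleftrightarrow> (\<forall>a\<in>set P. d a i = 0)"
  by (induction P) auto

text \<open>The membership assumptions say that neither arc has an end of the other in its interior;
  such arcs are disjoint or equal.\<close>

lemma arcs_eq:
  assumes "x \<noteq> y" "x' \<noteq> y'" "x' \<in> carc y x" "y' \<in> carc y x" "x \<in> carc y' x'" "y \<in> carc y' x'"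
    "inarc x y i" "inarc x' y' i"
  shows "x = x' \<and> y = y'"
  using assms unfolding carc_def inarc_def ccw_def mem_Collect_eq
  by (smt (verit) less_trans less_irrefl linorder_neqE_nat)

section \<open>The dimer quiver in terms of anticlockwise triangles\<close>

locale gl_dimer = triangulated_polygon +
  fixes m :: nat
  assumes m2: "m \<ge> 2"
begin

lemma tris_otri: "t \<in> tris n T \<Longrightarrow> (x, y, z) \<in> cyc3 t \<Longrightarrow> otri x y z \<and> t = sorted_triple x y z"
  by (auto simp: tris_def cyc3_def otri_def sorted_triple_def side_def ccw_def min_def max_def)

lemma otri_tris: "otri x y z \<Longrightarrow> sorted_triple x y z \<in> tris n T"
  using otri_less[of x y z]
  by (auto simp: tris_def otri_def sorted_triple_def side_def ccw_def min_def max_def split: if_splits)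

lemma cyc3_sorted_triple: "otri x y z \<Longrightarrow> cyc3 (sorted_triple x y z) = {(x, y, z), (y, z, x), (z, x, y)}"
  by (auto simp: cyc3_def otri_def sorted_triple_def ccw_def)

lemma tset_sorted_triple: "tset (sorted_triple x y z) = {x, y, z}"
  by (auto simp: tset_def sorted_triple_def)

lemma sorted_triple_rot: "otri x y z \<Longrightarrow> sorted_triple y z x = sorted_triple x y z"
  by (auto simp: otri_def sorted_triple_def ccw_def)

lemma tris_obtain:
  assumes "t \<in> tris n T" obtains x y z where "otri x y z" "t = sorted_triple x y z"
proof -
  obtain x y z where "t = (x, y, z)" by (cases t)
  then have "(x, y, z) \<in> cyc3 t" by (simp add: cyc3_def)
  then show ?thesis using that tris_otri[OF assms] by blast
qed

lemma wt_sorted_triple: "otri x y z \<Longrightarrow> wt (sorted_triple x y z) s u \<longleftrightarrow> wgt s u x y z"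
  using otri_distinct[of x y z] by (auto simp: wt_def wgt_def tset_sorted_triple)

text \<open>The segment from \<open>pt u x\<close> to \<open>pt u y\<close> survives the removal of
  2-cycles: for \<open>u z = 0\<close> it lies on the side \<open>x y\<close>, which is a diagonal
  unless it is a polygon edge.\<close>

definition kept :: "vtx \<Rightarrow> nat \<Rightarrow> nat \<Rightarrow> nat \<Rightarrow> bool" where
  "kept u x y z \<longleftrightarrow> u z > 0 \<or> y = nxt x"

lemma not_on_diag: "otri x y z \<Longrightarrow> \<not> (u z = 0 \<and> on_diag T x y) \<longleftrightarrow> kept u x y z"
  using on_diag_iff[of x y z] otri_less[of x y z] by (auto simp: otri_def kept_def)

lemma uparrows_sorted_triple: "otri x y z \<Longrightarrow> uparrows (sorted_triple x y z, u) = {ar u x y, ar u y z, ar u z x}"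
  by (auto simp: uparrows_def cyc3_sorted_triple ar_def)

lemma darrows_sorted_triple:
  "otri x y z \<Longrightarrow> darrows (sorted_triple x y z, u) = {ar (pt u z) x y, ar (pt u x) y z, ar (pt u y) z x}"
  by (auto simp: darrows_def cyc3_sorted_triple ar_def)

lemma ups_sorted_triple: "otri x y z \<Longrightarrow> (sorted_triple x y z, u) \<in> ups m n T \<longleftrightarrow> wgt (m - 1) u x y z"
  by (simp add: ups_def wt_sorted_triple otri_tris)

lemma downs_sorted_triple: "otri x y z \<Longrightarrow> (sorted_triple x y z, u) \<in> downs m n T \<longleftrightarrow> wgt (m - 2) u x y z"
  by (simp add: downs_def wt_sorted_triple otri_tris)

lemma glAr_iff:
  "a \<in> glAr m n T \<longleftrightarrow> (\<exists>u x y z. otri x y z \<and> wgt (m - 1) u x y z \<and> kept u x y z \<and> a = ar u x y)"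
proof
  assume "a \<in> glAr m n T"
  then obtain t u x y z where h: "a = (pt u x, pt u y)" "(t, u) \<in> ups m n T" "(x, y, z) \<in> cyc3 t"
    "\<not> (u z = 0 \<and> on_diag T x y)" unfolding glAr_def by blast
  then have "t \<in> tris n T" by (simp add: ups_def)
  then have "otri x y z" "t = sorted_triple x y z" using tris_otri h(3) by blast+
  then show "\<exists>u x y z. otri x y z \<and> wgt (m - 1) u x y z \<and> kept u x y z \<and> a = ar u x y"
    using h not_on_diag ups_sorted_triple unfolding ar_def by blast
next
  assume "\<exists>u x y z. otri x y z \<and> wgt (m - 1) u x y z \<and> kept u x y z \<and> a = ar u x y"
  then obtain u x y z where h: "otri x y z" "wgt (m - 1) u x y z" "kept u x y z" "a = ar u x y" by blast
  then have "(sorted_triple x y z, u) \<in> ups m n T" "(x, y, z) \<in> cyc3 (sorted_triple x y z)" "\<not> (u z = 0 \<and> on_diag T x y)"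
    using not_on_diag ups_sorted_triple cyc3_sorted_triple by auto
  then show "a \<in> glAr m n T" unfolding glAr_def using h(4) ar_def by blast
qed

lemma glV_iff: "v \<in> glV m n T \<longleftrightarrow> (\<exists>x y z. otri x y z \<and> wgt m v x y z)"
proof
  assume "v \<in> glV m n T"
  then obtain t where t: "t \<in> tris n T" "wt t m v" by (auto simp: glV_def)
  obtain x y z where xyz: "otri x y z" "t = sorted_triple x y z" using tris_obtain[OF t(1)] by blast
  then have "wgt m v x y z" using t(2) wt_sorted_triple by simp
  then show "\<exists>x y z. otri x y z \<and> wgt m v x y z" using xyz(1) by blast
next
  assume "\<exists>x y z. otri x y z \<and> wgt m v x y z"
  then obtain x y z where "otri x y z" "wgt m v x y z" by blast
  then have "sorted_triple x y z \<in> tris n T" "wt (sorted_triple x y z) m v" using otri_tris wt_sorted_triple by simp_all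
  then show "v \<in> glV m n T" unfolding glV_def by blast
qed

lemma kept_if_arrow:
  assumes "otri x y z" "ar u x y \<in> glAr m n T" shows "wgt (m - 1) u x y z \<and> kept u x y z"
proof -
  obtain u' x' y' z' where h: "otri x' y' z'" "wgt (m - 1) u' x' y' z'" "kept u' x' y' z'" "ar u x y = ar u' x' y'"
    using assms(2) glAr_iff by metis
  then have "u = u' \<and> x = x' \<and> y = y'" using ar_inj[OF h(4)] otri_distinct assms(1) by metis
  then show ?thesis using h otri_third assms(1) by metis
qed

lemma wgt_pt:
  assumes "x \<noteq> y" "x \<noteq> z" "y \<noteq> z"
  shows "wgt (Suc s) (pt u c) x y z \<longleftrightarrow> c \<in> {x, y, z} \<and> wgt s u x y z"
proof
  assume a: "wgt (Suc s) (pt u c) x y z"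
  have c: "c \<in> {x, y, z}"
  proof (rule ccontr)
    assume "c \<notin> {x, y, z}"
    then have "pt u c c = 0" using a by (simp add: wgt_def)
    then show False by (simp add: pt_apply)
  qed
  moreover have "wgt s u x y z"
  proof -
    have "u i = 0" if "i \<noteq> x \<and> i \<noteq> y \<and> i \<noteq> z" for i
      using a c that by (auto simp: wgt_def pt_apply)
    moreover have "pt u c x + pt u c y + pt u c z = Suc s" using a by (simp add: wgt_def)
    then have "u x + u y + u z = s" using c assms by (auto simp: pt_apply)
    ultimately show ?thesis by (simp add: wgt_def)
  qed
  ultimately show "c \<in> {x, y, z} \<and> wgt s u x y z" by simp
next
  assume a: "c \<in> {x, y, z} \<and> wgt s u x y z"
  then show "wgt (Suc s) (pt u c) x y z" using assms by (auto simp: wgt_def pt_apply)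
qed

lemma wgt_pt_m:
  assumes "otri x y z" shows "wgt m (pt u c) x y z \<longleftrightarrow> c \<in> {x, y, z} \<and> wgt (m - 1) u x y z"
proof -
  have e: "Suc (m - 1) = m" using m2 by simp
  show ?thesis using wgt_pt[of x y z "m - 1" u c] otri_distinct[OF assms] unfolding e by simp
qed

lemma wgt_pt_m1:
  assumes "otri x y z" shows "wgt (m - 1) (pt u c) x y z \<longleftrightarrow> c \<in> {x, y, z} \<and> wgt (m - 2) u x y z"
proof -
  have e: "Suc (m - 2) = m - 1" using m2 by simp
  show ?thesis using wgt_pt[of x y z "m - 2" u c] otri_distinct[OF assms] unfolding e by simp
qed

lemma pt_in_glV: "otri x y z \<Longrightarrow> wgt (m - 1) u x y z \<Longrightarrow> c \<in> {x, y, z} \<Longrightarrow> pt u c \<in> glV m n T"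
  using wgt_pt_m glV_iff by blast

text \<open>Taking one unit off \<open>z\<close> turns \<open>u\<close> into the base point of the
  downward triangle on the other side of the segment.\<close>

lemma glInt_iff:
  "a \<in> glInt m n T \<longleftrightarrow> (\<exists>u x y z. otri x y z \<and> wgt (m - 1) u x y z \<and> u z > 0 \<and> a = ar u x y)"
proof
  assume "a \<in> glInt m n T"
  then obtain D where D: "a \<in> glAr m n T" "D \<in> downs m n T" "a \<in> darrows D" by (auto simp: glInt_def)
  obtain t u where tu: "D = (t, u)" by (cases D)
  then obtain x y z where xyz: "a = (pt (pt u z) x, pt (pt u z) y)" "(x, y, z) \<in> cyc3 t"
    using D(3) by (auto simp: darrows_def)
  have "t \<in> tris n T" using D(2) tu by (simp add: downs_def)
  then have o: "otri x y z" "t = sorted_triple x y z" using tris_otri xyz(2) by blast+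
  then have "wgt (m - 1) (pt u z) x y z" using D(2) tu downs_sorted_triple wgt_pt_m1 by auto
  then show "\<exists>u x y z. otri x y z \<and> wgt (m - 1) u x y z \<and> u z > 0 \<and> a = ar u x y"
    using o xyz(1) by (intro exI[of _ "pt u z"] exI[of _ x] exI[of _ y] exI[of _ z]) (auto simp: ar_def pt_apply)
next
  assume "\<exists>u x y z. otri x y z \<and> wgt (m - 1) u x y z \<and> u z > 0 \<and> a = ar u x y"
  then obtain u x y z where h: "otri x y z" "wgt (m - 1) u x y z" "u z > 0" "a = ar u x y" by blast
  obtain u' where u': "u = pt u' z" using ex_pt[of u z] h(3) by blast
  have "a \<in> glAr m n T" using h glAr_iff kept_def by blast
  moreover have "(sorted_triple x y z, u') \<in> downs m n T" using h u' wgt_pt_m1 downs_sorted_triple by blast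
  moreover have "a \<in> darrows (sorted_triple x y z, u')" using h u' darrows_sorted_triple by blast
  ultimately show "a \<in> glInt m n T" by (auto simp: glInt_def)
qed

section \<open>Boundaries of the white and black faces\<close>

text \<open>The part of the boundary of the merged white face of \<open>(t, u)\<close> leading from \<open>pt u x\<close> to
  \<open>pt u y\<close>. It replaces the segment \<open>ar u x y\<close> where that segment was cancelled in a 2-cycle.\<close>

definition vpath :: "vtx \<Rightarrow> nat \<times> nat \<times> nat \<Rightarrow> nat \<Rightarrow> nat \<Rightarrow> arr list \<Rightarrow> bool" where
  "vpath u t x y P \<longleftrightarrow> chain (pt u x) P \<and> endpt (pt u x) P = pt u y \<and> degl (arrow_deg n) P = arcdeg n x y
     \<and> (\<forall>b\<in>set P. b \<in> glAr m n T \<and> (\<exists>t'. (up_adj m n T)\<^sup>*\<^sup>* (t, u) (t', u) \<and> b \<in> uparrows (t', u)))"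

lemma vpath_kept:
  assumes "otri x y z" "wgt (m - 1) u x y z" "kept u x y z"
  shows "vpath u (sorted_triple x y z) x y [ar u x y]"
proof -
  have "ar u x y \<in> glAr m n T" using assms glAr_iff by blast
  moreover have "ar u x y \<in> uparrows (sorted_triple x y z, u)" using uparrows_sorted_triple assms(1) by blast
  moreover have "degl (arrow_deg n) [ar u x y] = arcdeg n x y"
    using otri_distinct[OF assms(1)] by (auto simp: fun_eq_iff arrow_deg_ar)
  moreover have "(up_adj m n T)\<^sup>*\<^sup>* (sorted_triple x y z, u) (sorted_triple x y z, u)" by (rule rtranclp.rtrancl_refl)
  ultimately have "ar u x y \<in> glAr m n T \<and> (\<exists>t'. (up_adj m n T)\<^sup>*\<^sup>* (sorted_triple x y z, u) (t', u) \<and> ar u x y \<in> uparrows (t', u))"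
    "degl (arrow_deg n) [ar u x y] = arcdeg n x y" by blast+
  then show ?thesis by (simp add: vpath_def)
qed

text \<open>With \<open>u z = 0\<close> the segment lies on the diagonal \<open>x y\<close>, so the
  white nodes on its two sides are merged and the boundary runs along the other two sides of the
  upward triangle across.\<close>

lemma vpath_opp:
  assumes t: "otri x y z" "otri x s y" and u: "wgt (m - 1) u x y z" "u z = 0"
    and P: "vpath u (sorted_triple x s y) x s P" and Q: "vpath u (sorted_triple x s y) s y Q"
  shows "vpath u (sorted_triple x y z) x y (P @ Q)"
proof -
  note d = otri_distinct[OF t(1)] otri_distinct[OF t(2)]
  have sz: "s \<noteq> z" using t by (auto simp: otri_def ccw_def)
  have supp: "u i = 0" if "i \<noteq> x" "i \<noteq> y" for i using u that by (cases "i = z") (auto simp: wgt_def)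
  then have w: "wgt (m - 1) u x s y" using u d by (auto simp: wgt_def)
  have int: "{x, y, z} \<inter> {x, s, y} = {x, y}" using d sz by auto
  have "{x, y, z} \<noteq> {x, s, y}" using d sz by blast
  then have neq: "sorted_triple x y z \<noteq> sorted_triple x s y" using tset_sorted_triple by metis
  have "up_adj m n T (sorted_triple x y z, u) (sorted_triple x s y, u)"
    unfolding up_adj_def fst_conv snd_conv tset_sorted_triple int
  proof (intro conjI)
    show "(sorted_triple x y z, u) \<in> ups m n T" using t(1) u(1) by (simp only: ups_sorted_triple)
    show "(sorted_triple x s y, u) \<in> ups m n T" using t(2) w by (simp only: ups_sorted_triple)
    show "card {x, y} = 2" using d by simp
    show "\<forall>i. u i \<noteq> 0 \<longrightarrow> i \<in> {x, y}" using supp by fastforce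
    show "sorted_triple x y z \<noteq> sorted_triple x s y" by (rule neq)
  qed (rule refl)
  then have star: "(up_adj m n T)\<^sup>*\<^sup>* (sorted_triple x y z, u) (t', u)" if "(up_adj m n T)\<^sup>*\<^sup>* (sorted_triple x s y, u) (t', u)" for t'
    using that by (rule converse_rtranclp_into_rtranclp)
  have "arcdeg n x s i + arcdeg n s y i = arcdeg n x y i" for i
    using t(2) by (intro arcdeg_split) (simp add: otri_def)
  moreover have "degl (arrow_deg n) P i = arcdeg n x s i" "degl (arrow_deg n) Q i = arcdeg n s y i" for i
    using P Q by (simp_all add: vpath_def)
  ultimately have "degl (arrow_deg n) (P @ Q) = arcdeg n x y" by (simp add: fun_eq_iff)
  moreover have "chain (pt u x) (P @ Q)" "endpt (pt u x) (P @ Q) = pt u y"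
    using P Q by (simp_all add: vpath_def)
  moreover have "b \<in> glAr m n T \<and> (\<exists>t'. (up_adj m n T)\<^sup>*\<^sup>* (sorted_triple x y z, u) (t', u) \<and> b \<in> uparrows (t', u))"
    if "b \<in> set (P @ Q)" for b
  proof -
    have "b \<in> set P \<or> b \<in> set Q" using that by simp
    then have "b \<in> glAr m n T \<and> (\<exists>t'. (up_adj m n T)\<^sup>*\<^sup>* (sorted_triple x s y, u) (t', u) \<and> b \<in> uparrows (t', u))"
      using P Q unfolding vpath_def by blast
    then show ?thesis using star by blast
  qed
  ultimately show ?thesis unfolding vpath_def by blast
qed

text \<open>A cancelled segment is replaced by the two other sides of the triangle across it. Their
  arcs are shorter, so the recursion ends.\<close>

lemma vpath_ex:
  "otri x y z \<Longrightarrow> wgt (m - 1) u x y z \<Longrightarrow> \<exists>P. vpath u (sorted_triple x y z) x y P"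
proof (induction "cdist n x y" arbitrary: x y z rule: less_induct)
  case less
  note t = less(2)
  show ?case
  proof (cases "kept u x y z")
    case True
    then show ?thesis using vpath_kept less by blast
  next
    case False
    then have "y \<noteq> nxt x" by (simp add: kept_def)
    then obtain s where s: "otri x s y" using otri_ex_opp[OF t] by blast
    have w: "wgt (m - 1) u x s y"
      using less(3) False otri_distinct[OF t] otri_distinct[OF s] unfolding wgt_def kept_def
      by (metis add.right_neutral add.commute add.assoc gr0I)
    have "cdist n x s < cdist n x y" "cdist n s y < cdist n x y"
      using s otri_less[OF s] by (auto simp: otri_def intro: cdist_less cdist_less')
    then obtain P Q where "vpath u (sorted_triple x s y) x s P" "vpath u (sorted_triple s y x) s y Q"
      using less(1)[OF _ s w] less(1)[OF _ otri_rot[OF s] wgt_rot[OF w]] by blast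
    then show ?thesis using vpath_opp[OF t s less(3)] False sorted_triple_rot[OF s] by (auto simp: kept_def)
  qed
qed

text \<open>The second triangle cannot lie behind the side \<open>x y\<close>: either
  \<open>u z > 0\<close> and \<open>z\<close> must be one of its vertices, or \<open>x y\<close> is
  a polygon edge with nothing behind it. By symmetry neither arc has an end of the other in its
  interior.\<close>

lemma kept_arcs_disjoint:
  assumes t: "otri x y z" "otri x' y' z'" and u: "wgt s u x y z" "wgt s u x' y' z'"
    and k: "kept u x y z" "kept u x' y' z'" and i: "inarc x y i" "inarc x' y' i"
  shows "x = x' \<and> y = y'"
proof -
  have pos: "{x', y', z'} \<subseteq> carc y x"
    if t: "otri x y z" "otri x' y' z'" and u: "wgt s u x y z" "wgt s u x' y' z'"
      and k: "kept u x y z" for x y z x' y' z'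
  proof -
    have "\<not> {x', y', z'} \<subseteq> carc x y"
    proof
      assume a: "{x', y', z'} \<subseteq> carc x y"
      show False
      proof (cases "u z > 0")
        case True
        then have "z \<in> {x', y', z'}" using u(2) by (auto simp: wgt_def)
        then show False using a ccw_not_carc t(1) unfolding otri_def by blast
      next
        case False
        then have "carc x y \<inter> {..<n} \<subseteq> {x, y}" using k not_ccw_nxt by (auto simp: kept_def carc_def)
        then have "{x', y', z'} \<subseteq> {x, y}" using a otri_less[OF t(2)] by blast
        then have "card {x', y', z'} \<le> card {x, y}" by (intro card_mono) auto
        then show False using otri_distinct[OF t(2)] by (auto split: if_splits simp: card_insert_if)
      qed
    qed
    moreover have "carc y z \<subseteq> carc y x" "carc z x \<subseteq> carc y x" "{x, y, z} \<subseteq> carc y x"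
      using t(1) by (auto simp: otri_def carc_def ccw_def)
    ultimately show ?thesis using otri_position[OF t] by blast
  qed
  show ?thesis
    using pos[OF t u k(1)] pos[OF t(2,1) u(2,1) k(2)] otri_distinct[OF t(1)] otri_distinct[OF t(2)] i
    by (intro arcs_eq[of x y x' y' i]) auto
qed

lemma up_adj_star: "(up_adj m n T)\<^sup>*\<^sup>* U U' \<Longrightarrow> U \<in> ups m n T \<Longrightarrow> U' \<in> ups m n T \<and> snd U' = snd U"
  by (induction rule: rtranclp_induct) (auto simp: up_adj_def)

lemma ups_arrow:
  assumes "U \<in> ups m n T" "b \<in> uparrows U"
  obtains x y z where "otri x y z" "wgt (m - 1) (snd U) x y z" "b = ar (snd U) x y" "fst U = sorted_triple x y z"
proof -
  obtain t u where tu: "U = (t, u)" by (cases U)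
  obtain x y z where "(x, y, z) \<in> cyc3 t" "b = ar u x y"
    using assms(2) tu by (auto simp: uparrows_def ar_def)
  then show ?thesis using that[of x y z] assms(1) tu tris_otri[of t x y z] ups_sorted_triple by (auto simp: ups_def)
qed

text \<open>Merging along \<open>up_adj\<close> preserves the base point, so all arrows of the face
  have the base point \<open>u\<close>.\<close>

lemma whiteface_elem:
  assumes "otri x y z" "b \<in> whiteface m n T (ar u x y)"
  obtains x' y' z' where "otri x' y' z'" "wgt (m - 1) u x' y' z'" "kept u x' y' z'" "b = ar u x' y'"
proof -
  obtain U U' where U: "U \<in> ups m n T" "ar u x y \<in> uparrows U" "(up_adj m n T)\<^sup>*\<^sup>* U U'" "b \<in> uparrows U'"
    "b \<in> glAr m n T" using assms(2) by (auto simp: whiteface_def)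
  obtain a b' c where abc: "otri a b' c" "ar u x y = ar (snd U) a b'" using ups_arrow[OF U(1,2)] by metis
  have "snd U = u" using ar_inj[OF abc(2)] otri_distinct abc(1) assms(1) by metis
  then have U': "U' \<in> ups m n T" "snd U' = u" using up_adj_star U by auto
  obtain x' y' z' where x': "otri x' y' z'" "b = ar u x' y'" using ups_arrow[OF U'(1) U(4)] U'(2) by metis
  then show ?thesis using that kept_if_arrow U(5) by metis
qed

lemma vpath_whiteface:
  assumes "otri x y z" "wgt (m - 1) u x y z" "vpath u (sorted_triple x y z) c d P"
  shows "set P \<subseteq> whiteface m n T (ar u z x)"
proof
  fix b assume "b \<in> set P"
  then obtain t' where "b \<in> glAr m n T" "(up_adj m n T)\<^sup>*\<^sup>* (sorted_triple x y z, u) (t', u)" "b \<in> uparrows (t', u)"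
    using assms(3) by (auto simp: vpath_def)
  moreover have "(sorted_triple x y z, u) \<in> ups m n T" "ar u z x \<in> uparrows (sorted_triple x y z, u)"
    using assms ups_sorted_triple uparrows_sorted_triple by auto
  ultimately show "b \<in> whiteface m n T (ar u z x)" unfolding whiteface_def by blast
qed

lemma arrow_deg_ar_pos: "x \<noteq> y \<Longrightarrow> x < n \<Longrightarrow> arrow_deg n (ar u x y) x = 1"
  by (simp add: arrow_deg_ar arcdeg_def)

text \<open>The merged face need not be computed: its arrows have pairwise disjoint arcs, and the arcs of
  \<open>W1\<close>, \<open>W2\<close> and the omitted arrow already cover every polygon edge once.\<close>

lemma face_path_white:
  assumes t: "otri x y z" and u: "wgt (m - 1) u x y z" "u y > 0"
    and W1: "vpath u (sorted_triple x y z) x y W1" and W2: "vpath u (sorted_triple x y z) y z W2"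
  shows "face_path (whiteface m n T (ar u z x)) (ar u z x) (W1 @ W2)"
proof -
  let ?a = "ar u z x" and ?S = "whiteface m n T (ar u z x)"
  note d = otri_distinct[OF t] and l = otri_less[OF t]
  have deg: "degl (arrow_deg n) (W1 @ W2) i + arcdeg n z x i = (if i < n then 1 else 0)" for i
    using W1 W2 arcdeg_cycle[of x y z i n] t
    by (cases "i < n") (auto simp: vpath_def otri_def, auto simp: arcdeg_def)
  have kz: "otri z x y" "wgt (m - 1) u z x y" "kept u z x y"
    using t u wgt_rot otri_rot by (auto simp: kept_def)
  have aS: "?a \<in> ?S"
    using vpath_whiteface[OF t u(1), of z x "[?a]"] vpath_kept[OF kz] sorted_triple_rot[OF kz(1)] by simp
  have sub: "set (W1 @ W2) \<subseteq> ?S" using vpath_whiteface[OF t u(1)] W1 W2 by simp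
  \<comment> \<open>The polygon edge at \<open>z\<close> is used by the omitted arrow and hence by
    no arrow of \<open>W1 @ W2\<close>.\<close>
  have "arcdeg n z x z = 1" using l by (simp add: arcdeg_def)
  then have "degl (arrow_deg n) (W1 @ W2) z = 0" using deg[of z] l by simp
  then have a_notin: "?a \<notin> set (W1 @ W2)"
    using arrow_deg_ar_pos[of z x u] l d by (force simp: degl_zero_iff simp del: degl_append)
  have elem: "\<exists>x' y' z'. otri x' y' z' \<and> wgt (m - 1) u x' y' z' \<and> kept u x' y' z' \<and> b = ar u x' y'" if "b \<in> ?S" for b
    using whiteface_elem[OF kz(1) that] by metis
  have "b \<in> set (W1 @ W2)" if b: "b \<in> ?S" "b \<noteq> ?a" for b
  proof -
    obtain x' y' z' where x': "otri x' y' z'" "wgt (m - 1) u x' y' z'" "kept u x' y' z'" "b = ar u x' y'"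
      using elem b(1) by blast
    \<comment> \<open>Some arrow \<open>c\<close> of the cycle covers the edge at \<open>x'\<close>,
      which \<open>b\<close> covers too; disjointness of arcs identifies \<open>c\<close> with
      \<open>b\<close>.\<close>
    have "degl (arrow_deg n) (?a # W1 @ W2) x' = 1"
      using deg[of x'] otri_less[OF x'(1)] arrow_deg_ar[of z x n u] d by simp
    then have "degl (arrow_deg n) (?a # W1 @ W2) x' > 0" by linarith
    then obtain c where c: "c \<in> set (?a # W1 @ W2)" "arrow_deg n c x' > 0" using degl_pos by blast
    have "c \<in> ?S" using c(1) sub aS by auto
    then obtain p q r where p: "otri p q r" "wgt (m - 1) u p q r" "kept u p q r" "c = ar u p q"
      using elem by blast
    have "inarc p q x'" using c(2) p(4) arrow_deg_ar[of p q n u] otri_distinct[OF p(1)]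
      by (auto simp: arcdeg_def split: if_splits)
    then have "p = x' \<and> q = y'" using kept_arcs_disjoint[OF p(1) x'(1) p(2) x'(2) p(3) x'(3)] by simp
    then show ?thesis using c(1) p(4) x'(4) b(2) by auto
  qed
  then have "set (W1 @ W2) = ?S - {?a}" using sub a_notin by blast
  moreover have "distinct (W1 @ W2)"
  proof (rule distinct_if_degl)
    show "degl (arrow_deg n) (W1 @ W2) i \<le> 1" for i using deg[of i] by (simp split: if_splits)
    show "\<exists>i. arrow_deg n b i > 0" if b: "b \<in> set (W1 @ W2)" for b
    proof -
      obtain x' y' z' where "otri x' y' z'" "b = ar u x' y'" using b sub elem by blast
      then show ?thesis using arrow_deg_ar_pos[of x' y' u] otri_less otri_distinct by (metis zero_less_one)
    qed
  qed
  moreover have "chain (pt u x) (W1 @ W2)" "endpt (pt u x) (W1 @ W2) = pt u z"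
    using W1 W2 by (auto simp: vpath_def)
  ultimately show ?thesis using aS by (simp add: face_path_def)
qed

lemma black_arrow:
  assumes t: "otri x y z" and u: "wgt (m - 2) u x y z" shows "ar (pt u z) x y \<in> glAr m n T"
proof -
  have "wgt (m - 1) (pt u z) x y z" using wgt_pt_m1[OF t] u by simp
  moreover have "kept (pt u z) x y z" by (simp add: kept_def pt_apply)
  ultimately show ?thesis unfolding glAr_iff using t by blast
qed

text \<open>An arrow determines its base point and its triangle, so it lies in one downward
  triangle. No segment of that triangle was cancelled, as each has mass at the vertex opposite to
  its side.\<close>

lemma blackface_eq:
  assumes t: "otri x y z" and u: "wgt (m - 2) u x y z"
  shows "blackface m n T (ar (pt u z) x y) = {ar (pt u z) x y, ar (pt u x) y z, ar (pt u y) z x}"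
proof -
  note dt = darrows_sorted_triple[OF t, of u] and d = otri_distinct[OF t]
  have "darrows (sorted_triple x y z, u) \<subseteq> glAr m n T"
    unfolding dt using black_arrow[OF t u] black_arrow[OF otri_rot[OF t] wgt_rot[OF u]]
      black_arrow[OF otri_rot'[OF t] wgt_rot[OF wgt_rot[OF u]]] by blast
  moreover have "(sorted_triple x y z, u) \<in> downs m n T" using downs_sorted_triple t u by blast
  moreover have "D = (sorted_triple x y z, u)" if D: "D \<in> downs m n T" "ar (pt u z) x y \<in> darrows D" for D
  proof -
    obtain t' u' where tu: "D = (t', u')" by (cases D)
    obtain x' y' z' where c: "(x', y', z') \<in> cyc3 t'" "ar (pt u z) x y = ar (pt u' z') x' y'"
      using D(2) tu by (auto simp: darrows_def ar_def)
    have "t' \<in> tris n T" using D(1) tu by (simp add: downs_def)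
    then have t': "otri x' y' z'" "t' = sorted_triple x' y' z'" using tris_otri c(1) by blast+
    have "pt u z = pt u' z' \<and> x = x' \<and> y = y'" using ar_inj[OF c(2)] d otri_distinct[OF t'(1)] by simp
    moreover then have "z = z'" using t t'(1) otri_third by metis
    ultimately show ?thesis using t'(2) tu pt_inj by metis
  qed
  ultimately show ?thesis unfolding blackface_def using dt by blast
qed

lemma face_path_black:
  assumes t: "otri x y z" and u: "wgt (m - 2) u x y z"
  shows "face_path (blackface m n T (ar (pt u z) x y)) (ar (pt u z) x y) [ar (pt u y) z x, ar (pt u x) y z]"
proof -
  note d = otri_distinct[OF t]
  have "ar (pt u z) x y \<noteq> ar (pt u x) y z" "ar (pt u z) x y \<noteq> ar (pt u y) z x" "ar (pt u x) y z \<noteq> ar (pt u y) z x"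
    using ar_inj d by metis+
  then show ?thesis unfolding blackface_eq[OF t u] face_path_def by (auto simp: pt_commute)
qed

text \<open>The relation of the internal arrow \<open>ar (pt u y) z x\<close>: the moves from
  \<open>x\<close> to \<open>y\<close> and from \<open>y\<close> to \<open>z\<close> commute. On the
  white side each is realised by a \<open>vpath\<close>, as the segment itself may have been
  cancelled.\<close>

lemma vpath_relation:
  assumes t: "otri x y z" and u: "wgt (m - 2) u x y z"
    and W1: "vpath (pt u y) (sorted_triple x y z) x y W1" and W2: "vpath (pt u y) (sorted_triple x y z) y z W2"
  shows "psub (pbasis (pt (pt u y) x, W1 @ W2)) (pbasis (pt (pt u y) x, [ar (pt u x) y z, ar (pt u z) x y])) \<in> glR m n T"
proof -
  have w: "wgt (m - 1) (pt u y) x y z" using wgt_pt_m1 t u by blast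
  have "face_path (whiteface m n T (ar (pt u y) z x)) (ar (pt u y) z x) (W1 @ W2)"
    using face_path_white[OF t w _ W1 W2] by (simp add: pt_apply)
  moreover have "face_path (blackface m n T (ar (pt u y) z x)) (ar (pt u y) z x) [ar (pt u x) y z, ar (pt u z) x y]"
    using face_path_black[OF otri_rot'[OF t] wgt_rot[OF wgt_rot[OF u]]] .
  moreover have "ar (pt u y) z x \<in> glInt m n T"
    using w otri_rot'[OF t] wgt_rot[OF wgt_rot[OF w]] unfolding glInt_iff by (metis pt_apply zero_less_Suc)
  ultimately have "\<exists>a p q. psub (pbasis (pt (pt u y) x, W1 @ W2)) (pbasis (pt (pt u y) x, [ar (pt u x) y z, ar (pt u z) x y]))
      = psub (pbasis (snd a, p)) (pbasis (snd a, q)) \<and> a \<in> glInt m n T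
      \<and> face_path (whiteface m n T a) a p \<and> face_path (blackface m n T a) a q"
    by (intro exI[of _ "ar (pt u y) z x"] exI[of _ "W1 @ W2"] exI[of _ "[ar (pt u x) y z, ar (pt u z) x y]"]) simp
  then show ?thesis unfolding glR_def by simp
qed

section \<open>Arrows as transport and homogeneity of the relations\<close>

lemma degl_arrow_deg_eqI: "(\<And>i. i < n \<Longrightarrow> degl (arrow_deg n) P i = degl (arrow_deg n) Q i) \<Longrightarrow> degl (arrow_deg n) P = degl (arrow_deg n) Q"
  using degl_arrow_deg_ge by (metis ext not_le)

text \<open>The indicator of an arc jumps up at its start and down at its end; this is the flow
  equation for a single unit.\<close>

lemma arcdeg_step:
  assumes "x \<noteq> y" "x < n" "y < n" "j < n"
  shows "arcdeg n x y (nxt j) + (if nxt j = y then 1 else 0) = arcdeg n x y j + (if nxt j = x then 1 else 0)"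
proof -
  have "inarc x y j" if "nxt j = y" using that assms
    by (cases "Suc j = n") (auto simp: inarc_def ccw_def nxt_def)
  moreover have "\<not> inarc x y j" if "nxt j = x" using that assms
    by (auto simp: inarc_def ccw_def nxt_def split: if_splits)
  moreover have "\<not> inarc x y (nxt j)" if "nxt j = y" using that assms by (auto simp: inarc_def ccw_def)
  moreover have "inarc x y (nxt j) \<longleftrightarrow> inarc x y j" if "nxt j \<noteq> x" "nxt j \<noteq> y"
    using that assms by (auto simp: inarc_def ccw_def nxt_def split: if_splits)
  ultimately show ?thesis using assms by (cases "nxt j = x"; cases "nxt j = y") (auto simp: arcdeg_def)
qed

lemma flow_arc_move: "x \<noteq> y \<Longrightarrow> x < n \<Longrightarrow> y < n \<Longrightarrow> flow (pt u x) (arcdeg n x y) (pt u y)"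
  using arcdeg_step[of x y] by (force simp: flow_def pt_apply)

lemma flow_add: "flow v D w \<Longrightarrow> flow w D' w' \<Longrightarrow> flow v (\<lambda>i. D i + D' i) w'"
  unfolding flow_def by (metis (no_types, lifting) add.assoc add.commute)

lemma flow_diff:
  assumes "flow v D w" "flow v E v'" "\<And>i. i < n \<Longrightarrow> E i \<le> D i"
  shows "flow v' (\<lambda>i. D i - E i) w"
  unfolding flow_def
proof (intro allI impI)
  fix j assume j: "j < n"
  then have "D (nxt j) + w (nxt j) = D j + v (nxt j)" "E (nxt j) + v' (nxt j) = E j + v (nxt j)"
    "E j \<le> D j" "E (nxt j) \<le> D (nxt j)" using assms by (auto simp: flow_def)
  then show "D (nxt j) - E (nxt j) + w (nxt j) = D j - E j + v' (nxt j)" by linarith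
qed

lemma flow_path: "chain v P \<Longrightarrow> set P \<subseteq> glAr m n T \<Longrightarrow> flow v (degl (arrow_deg n) P) (endpt v P)"
proof (induction P arbitrary: v)
  case Nil
  then show ?case by (simp add: flow_def)
next
  case (Cons a P)
  then obtain u x y z where a: "otri x y z" "a = ar u x y" using glAr_iff[of a] by auto
  have "flow v (arrow_deg n a) (snd a)"
    using Cons.prems(1) a otri_less[OF a(1)] otri_distinct[OF a(1)] flow_arc_move[of x y u]
    by (auto simp: arrow_deg_ar)
  then show ?case using flow_add[of v "arrow_deg n a" "snd a"] Cons
    by (simp add: degl_def)
qed

text \<open>Both complements of \<open>a\<close> are plans with the same ends, and both vanish on
  the edge at \<open>x\<close>, so \<open>flow_unique\<close> makes their degrees equal.\<close>

lemma face_paths_key: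
  assumes p: "face_path S a p" and q: "face_path S' a q"
    and S: "S \<subseteq> glAr m n T" "S' \<subseteq> glAr m n T" and a: "a = ar u x y" "x < n"
    and dis: "\<And>b. b \<in> S \<union> S' \<Longrightarrow> b \<noteq> a \<Longrightarrow> arrow_deg n b x = 0"
  shows "pkey (arrow_deg n) (snd a, p) = pkey (arrow_deg n) (snd a, q)"
proof -
  have "degl (arrow_deg n) p x = 0" "degl (arrow_deg n) q x = 0"
    using p q dis by (auto simp: degl_zero_iff face_path_def)
  moreover have "flow (snd a) (degl (arrow_deg n) p) (fst a)" "flow (snd a) (degl (arrow_deg n) q) (fst a)"
    using flow_path[of "snd a" p] flow_path[of "snd a" q] p q S by (auto simp: face_path_def)
  ultimately have "degl (arrow_deg n) p = degl (arrow_deg n) q"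
    using flow_unique[of "snd a" _ "fst a" _ x] a(2) by (intro degl_arrow_deg_eqI) metis
  then show ?thesis using p q by (simp add: pkey_def pend_def face_path_def)
qed

text \<open>The other arrows of the white face avoid the edge at \<open>x\<close> because kept arcs
  are disjoint; those of the black face are known explicitly.\<close>

lemma glR_key:
  assumes "r \<in> glR m n T"
  shows "\<exists>p q. r = psub (pbasis p) (pbasis q) \<and> pkey (arrow_deg n) p = pkey (arrow_deg n) q"
proof -
  obtain a p q where r: "r = psub (pbasis (snd a, p)) (pbasis (snd a, q))" "a \<in> glInt m n T"
      "face_path (whiteface m n T a) a p" "face_path (blackface m n T a) a q"
    using assms unfolding glR_def by blast
  obtain u x y z where a: "otri x y z" "wgt (m - 1) u x y z" "u z > 0" "a = ar u x y"
    using r(2) glInt_iff by blast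
  note d = otri_distinct[OF a(1)] and l = otri_less[OF a(1)]
  have k: "kept u x y z" using a(3) by (simp add: kept_def)
  obtain u' where u': "u = pt u' z" using ex_pt[of u z] a(3) by blast
  have w': "wgt (m - 2) u' x y z" using a u' wgt_pt_m1 by blast
  have "arrow_deg n b x = 0" if b: "b \<in> whiteface m n T a" "b \<noteq> a" for b
  proof -
    obtain x' y' z' where x': "otri x' y' z'" "wgt (m - 1) u x' y' z'" "kept u x' y' z'" "b = ar u x' y'"
      using whiteface_elem a b(1) by metis
    have "\<not> inarc x' y' x"
      using kept_arcs_disjoint[OF x'(1) a(1) x'(2) a(2) x'(3) k, of x] b(2) a(4) x'(4) by auto
    then show ?thesis using x' arrow_deg_ar[of x' y' n u] otri_distinct[OF x'(1)] by (simp add: arcdeg_def)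
  qed
  moreover have "arrow_deg n b x = 0" if b: "b \<in> blackface m n T a" "b \<noteq> a" for b
    using b a(1,4) blackface_eq[OF a(1) w'] u' d
    by (auto simp: arrow_deg_ar arcdeg_def inarc_def otri_def ccw_def)
  moreover have sub: "whiteface m n T a \<subseteq> glAr m n T" "blackface m n T a \<subseteq> glAr m n T"
    by (auto simp: whiteface_def blackface_def)
  ultimately have "pkey (arrow_deg n) (snd a, p) = pkey (arrow_deg n) (snd a, q)"
    using r(3,4) a(4) l sub by (intro face_paths_key[of "whiteface m n T a" a p "blackface m n T a" q u x y]) blast+
  then show ?thesis using r(1) by blast
qed

section \<open>Paths realising a transport plan\<close>

definition path_between :: "vtx \<Rightarrow> arr list \<Rightarrow> vtx \<Rightarrow> bool" where
  "path_between v P w \<longleftrightarrow> valid_path (glV m n T) (glAr m n T) (v, P) \<and> endpt v P = w"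

definition path_cong :: "vtx \<Rightarrow> arr list \<Rightarrow> arr list \<Rightarrow> bool" where
  "path_cong v P Q \<longleftrightarrow> pcong (glV m n T) (glAr m n T) (glR m n T) (v, P) (v, Q)"

lemma arrow_in_glV: "a \<in> glAr m n T \<Longrightarrow> fst a \<in> glV m n T \<and> snd a \<in> glV m n T"
  using glAr_iff[of a] pt_in_glV by fastforce

lemma path_between_Nil [simp]: "path_between v [] w \<longleftrightarrow> v \<in> glV m n T \<and> w = v"
  by (auto simp: path_between_def valid_path_def)

lemma path_between_Cons: "path_between v (a # P) w \<longleftrightarrow> a \<in> glAr m n T \<and> fst a = v \<and> path_between (snd a) P w"
  using arrow_in_glV[of a] by (auto simp: path_between_def valid_path_def)

lemma path_between_append: "path_between v P w \<Longrightarrow> path_between w Q x \<Longrightarrow> path_between v (P @ Q) x"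
  by (auto simp: path_between_def valid_path_def)

lemma path_between_flow: "path_between v P w \<Longrightarrow> flow v (degl (arrow_deg n) P) w"
  using flow_path[of v P] by (auto simp: path_between_def valid_path_def)

lemma path_between_end: "path_between v P w \<Longrightarrow> w \<in> glV m n T"
  by (induction P arbitrary: v) (auto simp: path_between_Cons)

lemma vpath_path_between:
  "otri x y z \<Longrightarrow> wgt (m - 1) u x y z \<Longrightarrow> c \<in> {x, y, z} \<Longrightarrow> vpath u (sorted_triple x y z) c d P \<Longrightarrow> path_between (pt u c) P (pt u d)"
  using pt_in_glV[of x y z u c] by (auto simp: vpath_def path_between_def valid_path_def)

lemma path_cong_refl: "path_cong v P P"
  and path_cong_sym: "path_cong v P Q \<Longrightarrow> path_cong v Q P"
  and path_cong_trans: "path_cong v P Q \<Longrightarrow> path_cong v Q R \<Longrightarrow> path_cong v P R"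
  unfolding path_cong_def by (rule pcong_refl, erule pcong_sym, erule pcong_trans)

lemma path_cong_append: "path_cong v P Q \<Longrightarrow> path_between w R x \<Longrightarrow> endpt v P = w \<Longrightarrow> endpt v Q = w \<Longrightarrow> path_cong v (P @ R) (Q @ R)"
  using pcong_right[of "glV m n T" "glAr m n T" "glR m n T" "(v, P)" "(v, Q)" "(w, R)"]
  by (auto simp: path_cong_def path_between_def pend_def pcat_def)

lemma path_cong_Cons: "path_cong (snd a) P Q \<Longrightarrow> a \<in> glAr m n T \<Longrightarrow> path_cong (fst a) (a # P) (a # Q)"
  using pcong_left[of "glV m n T" "glAr m n T" "glR m n T" "(snd a, P)" "(snd a, Q)" "(fst a, [a])"]
    arrow_in_glV[of a]
  by (auto simp: path_cong_def valid_path_def pend_def pcat_def)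

text \<open>Induction on the total degree. The move found by \<open>ex_move\<close> may be along a
  cancelled segment; the \<open>vpath\<close> replacing it has the same ends and the same
  degree.\<close>

lemma path_ex:
  assumes w: "w \<in> glV m n T"
  shows "v \<in> glV m n T \<Longrightarrow> flow v D w \<Longrightarrow> \<exists>P. path_between v P w \<and> (\<forall>i<n. degl (arrow_deg n) P i = D i)"
proof (induction "\<Sum>i<n. D i" arbitrary: v D rule: less_induct)
  case less
  obtain a b c where abc: "otri a b c" "wgt m w a b c" using w glV_iff by blast
  obtain p q r where pqr: "otri p q r" "wgt m v p q r" using less(2) glV_iff by blast
  show ?case
  proof (cases "\<exists>i<n. D i > 0")
    case False
    \<comment> \<open>The zero plan moves nothing, so the empty path will do.\<close>
    have "w j = v j" for j
    proof (cases "j < n")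
      case True
      then obtain i where "i < n" "nxt i = j" using ex_prev by metis
      then show ?thesis using False less(3) True by (auto simp: flow_def)
    next
      case False
      then have "w j = 0" "v j = 0" using otri_less[OF abc(1)] otri_less[OF pqr(1)] abc(2) pqr(2)
        by (auto simp: wgt_def)
      then show ?thesis by simp
    qed
    then have "w = v" by auto
    then show ?thesis using False less(2) by (intro exI[of _ "[]"]) auto
  next
    case True
    then obtain i where i: "i < n" "D i > 0" by blast
    have w0: "\<And>j. j \<notin> {a, b, c} \<Longrightarrow> w j = 0" using abc(2) by (auto simp: wgt_def)
    have m0: "m > 0" using m2 by simp
    obtain x y z where x: "otri x y z" "wgt m v x y z" "v x > 0" "\<forall>i<n. inarc x y i \<longrightarrow> D i > 0"
      by (rule ex_move[OF pqr m0 abc(1) w0 less(3) i])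
    obtain u where u: "v = pt u x" using ex_pt[of v x] x(3) by blast
    have wu: "wgt (m - 1) u x y z" using wgt_pt_m[OF x(1)] x(2) u by blast
    obtain P where P: "vpath u (sorted_triple x y z) x y P" using vpath_ex[OF x(1) wu] by blast
    have E: "arcdeg n x y i \<le> D i" if "i < n" for i using x(4) that by (simp add: arcdeg_def Suc_le_eq)
    note l = otri_less[OF x(1)] and d = otri_distinct[OF x(1)]
    have fl: "flow (pt u y) (\<lambda>i. D i - arcdeg n x y i) w"
      using flow_diff[OF less(3) _ E] flow_arc_move[of x y u] l d u by blast
    have "(\<Sum>i<n. D i - arcdeg n x y i) < (\<Sum>i<n. D i)"
    proof (rule sum_strict_mono_ex1)
      have "D x > 0" using x(4) l by simp
      then show "\<exists>i\<in>{..<n}. D i - arcdeg n x y i < D i"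
        using l by (intro bexI[of _ x]) (auto simp: arcdeg_def)
    qed auto
    then obtain Q where Q: "path_between (pt u y) Q w" "\<forall>i<n. degl (arrow_deg n) Q i = D i - arcdeg n x y i"
      using less(1)[OF _ _ fl] pt_in_glV[OF x(1) wu] by blast
    have "path_between v (P @ Q) w" using path_between_append[OF vpath_path_between[OF x(1) wu _ P] Q(1)] u by simp
    moreover have "degl (arrow_deg n) (P @ Q) i = D i" if "i < n" for i
      using P Q(2) E that by (simp add: vpath_def)
    ultimately show ?thesis by blast
  qed
qed

text \<open>If \<open>D\<close> leaves room for both moves, the two sides of the relation are
  extended by a common rest, which \<open>path_ex\<close> supplies. \<open>W1\<close> stays general
  because its first arrow may come from a replacement of a cancelled segment.\<close>

lemma relation_completion:
  assumes t: "otri x y z" and u: "wgt (m - 2) u x y z"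
    and W1: "vpath (pt u y) (sorted_triple x y z) x y W1"
    and w: "w \<in> glV m n T" and fl: "flow (pt (pt u y) x) D w"
    and D: "\<And>i. i < n \<Longrightarrow> arcdeg n x y i + arcdeg n y z i \<le> D i"
  shows "\<exists>R S. path_between (pt (pt u y) x) (W1 @ R) w \<and> path_between (pt (pt u y) x) (ar (pt u x) y z # S) w
    \<and> (\<forall>i<n. degl (arrow_deg n) (W1 @ R) i = D i) \<and> (\<forall>i<n. degl (arrow_deg n) (ar (pt u x) y z # S) i = D i)
    \<and> path_cong (pt (pt u y) x) (W1 @ R) (ar (pt u x) y z # S)"
proof -
  let ?v = "pt (pt u y) x" and ?B = "[ar (pt u x) y z, ar (pt u z) x y]"
  note d = otri_distinct[OF t] and l = otri_less[OF t]
  have w1: "wgt (m - 1) (pt u y) x y z" using wgt_pt_m1[OF t] u by simp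
  obtain W2 where W2: "vpath (pt u y) (sorted_triple x y z) y z W2"
    using vpath_ex[OF otri_rot[OF t] wgt_rot[OF w1]] sorted_triple_rot[OF t] by auto
  have W: "path_between ?v (W1 @ W2) (pt (pt u y) z)"
    using path_between_append vpath_path_between[OF t w1 _ W1] vpath_path_between[OF t w1 _ W2] by blast
  have B: "path_between ?v ?B (pt (pt u y) z)"
    using black_arrow[OF t u] black_arrow[OF otri_rot[OF t] wgt_rot[OF u]] arrow_in_glV[of "ar (pt u z) x y"]
    by (auto simp: path_between_Cons pt_commute)
  have cgWB: "path_cong ?v (W1 @ W2) ?B"
    unfolding path_cong_def pcong_def by (rule rel_ideal.gen) (rule vpath_relation[OF t u W1 W2])
  have degW: "degl (arrow_deg n) (W1 @ W2) i = arcdeg n x y i + arcdeg n y z i" for i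
    using W1 W2 by (simp add: vpath_def)
  have degB: "degl (arrow_deg n) ?B i = arcdeg n x y i + arcdeg n y z i" for i
    using d by (simp add: arrow_deg_ar)
  have "flow (pt (pt u y) z) (\<lambda>i. D i - degl (arrow_deg n) (W1 @ W2) i) w"
    using flow_diff[OF fl path_between_flow[OF W]] D degW by simp
  then obtain R where R: "path_between (pt (pt u y) z) R w" "\<forall>i<n. degl (arrow_deg n) R i = D i - degl (arrow_deg n) (W1 @ W2) i"
    using path_ex[OF w] path_between_end[OF W] by blast
  have "path_between ?v ((W1 @ W2) @ R) w" "path_between ?v (?B @ R) w" using path_between_append W B R(1) by blast+
  moreover have "path_cong ?v ((W1 @ W2) @ R) (?B @ R)"
    using path_cong_append[OF cgWB R(1)] W B by (simp add: path_between_def)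
  moreover have "degl (arrow_deg n) ((W1 @ W2) @ R) i = D i" "degl (arrow_deg n) (?B @ R) i = D i" if "i < n" for i
    using R(2) D[OF that] degW[of i] degB[of i] that by simp_all
  ultimately show ?thesis
    by (intro exI[of _ "W2 @ R"] exI[of _ "[ar (pt u z) x y] @ R"]) simp
qed

section \<open>The diamond argument for paths of equal degree\<close>

definition joinable :: "vtx \<Rightarrow> (nat \<Rightarrow> nat) \<Rightarrow> vtx \<Rightarrow> arr \<Rightarrow> arr \<Rightarrow> bool" where
  "joinable v D w a b \<longleftrightarrow> (\<exists>R S. path_between v (a # R) w \<and> path_between v (b # S) w
    \<and> (\<forall>i<n. degl (arrow_deg n) (a # R) i = D i) \<and> (\<forall>i<n. degl (arrow_deg n) (b # S) i = D i)
    \<and> path_cong v (a # R) (b # S))"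

lemma joinable_sym: "joinable v D w a b \<Longrightarrow> joinable v D w b a"
  unfolding joinable_def using path_cong_sym by blast

text \<open>The vertex has a unit at \<open>x\<close> and one at \<open>y\<close>, so one relation
  involves both moves. Their arcs are disjoint, hence positivity of \<open>D\<close> on both leaves
  room for both.\<close>

lemma joinable_same:
  assumes t: "otri x y z" and a: "wgt (m - 1) u x y z" "kept u x y z"
    and v: "pt u x = v" "pt u' y = v" and w: "w \<in> glV m n T" and fl: "flow v D w"
    and D: "\<And>i. i < n \<Longrightarrow> inarc x y i \<or> inarc y z i \<Longrightarrow> D i > 0"
  shows "joinable v D w (ar u x y) (ar u' y z)"
proof -
  note d = otri_distinct[OF t]
  have "pt u x y = pt u' y y" using v by simp
  then have "u y > 0" using d by (simp add: pt_apply)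
  then obtain u0 where u0: "u = pt u0 y" using ex_pt by blast
  have "pt (pt u0 x) y = pt u' y" using v u0 pt_commute by metis
  then have u': "u' = pt u0 x" using pt_inj by metis
  have w0: "wgt (m - 2) u0 x y z" using a(1) u0 wgt_pt_m1[OF t] by blast
  have "arcdeg n x y i + arcdeg n y z i \<le> D i" if "i < n" for i
    using D[OF that] arcdeg_cycle[of x y z i n] t that by (auto simp: otri_def arcdeg_def)
  then show ?thesis
    using relation_completion[OF t w0 _ w, of "[ar u x y]" D] vpath_kept[OF t a] v fl u0 u'
    unfolding joinable_def by auto
qed

text \<open>Here \<open>v\<close> lies on the diagonal \<open>x z\<close>. The boundary of the merged white face from \<open>x\<close> to \<open>z\<close>
  begins with the first arrow and commutes with the second one.\<close>

lemma joinable_across: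
  assumes t: "otri x y z" and t': "otri z s x"
    and a: "wgt (m - 1) u x y z" "u y = 0" and v: "pt u x = v" "pt u' z = v"
    and w: "w \<in> glV m n T" and fl: "flow v D w"
    and D: "\<And>i. i < n \<Longrightarrow> inarc x z i \<or> inarc z s i \<Longrightarrow> D i > 0"
  shows "joinable v D w (ar u x y) (ar u' z s)"
proof -
  note d = otri_distinct[OF t] and d' = otri_distinct[OF t']
  have o: "otri x z s" using otri_rot'[OF t'] .
  have "pt u x z = pt u' z z" using v by simp
  then have uz: "u z > 0" using d by (simp add: pt_apply)
  then obtain u0 where u0: "u = pt u0 z" using ex_pt by blast
  have "pt (pt u0 x) z = pt u' z" using v u0 pt_commute by metis
  then have u': "u' = pt u0 x" using pt_inj by metis
  have "y \<noteq> s" using t t' by (auto simp: otri_def ccw_def)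
  then have us: "u s = 0" using a d d' by (simp add: wgt_def)
  have w1: "wgt (m - 1) u x z s"
    using a us d d' unfolding wgt_def by (metis add.right_neutral)
  have w0: "wgt (m - 2) u0 x z s" using w1 u0 wgt_pt_m1[OF o] by blast
  have P: "vpath u (sorted_triple x y z) x y [ar u x y]" using vpath_kept[OF t a(1)] uz by (simp add: kept_def)
  obtain Q where Q: "vpath u (sorted_triple x y z) y z Q"
    using vpath_ex[OF otri_rot[OF t] wgt_rot[OF a(1)]] sorted_triple_rot[OF t] by auto
  \<comment> \<open>Seen from the triangle \<open>x z s\<close>, the way from \<open>x\<close> over
    \<open>y\<close> to \<open>z\<close> replaces the cancelled segment from \<open>x\<close> to
    \<open>z\<close>.\<close>
  have W: "vpath (pt u0 z) (sorted_triple x z s) x z (ar u x y # Q)"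
    using vpath_opp[OF o t w1 us P Q] u0 by simp
  have "arcdeg n x z i + arcdeg n z s i \<le> D i" if "i < n" for i
    using D[OF that] arcdeg_cycle[of x z s i n] o that by (auto simp: otri_def arcdeg_def)
  then show ?thesis
    using relation_completion[OF o w0 W w, of D] v fl u0 u' unfolding joinable_def append_Cons by blast
qed

text \<open>Mass at the common source sits on vertices of both triangles. Hence the second arrow
  follows the next or the previous side of the same triangle, or the triangles share the side
  \<open>x z\<close>, which carries all the mass, and the arrows start from its two ends.\<close>

lemma arrows_at_vertex:
  assumes a: "otri x y z" "wgt (m - 1) u x y z" "kept u x y z"
    and b: "otri x' y' z'" "wgt (m - 1) u' x' y' z'" "kept u' x' y' z'"
    and v: "pt u x = pt u' x'" and neq: "ar u x y \<noteq> ar u' x' y'"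
  shows "(x' = y \<and> y' = z) \<or> (x' = z \<and> y' = x) \<or> (x' = z \<and> z' = x \<and> u y = 0 \<and> u' y' = 0)"
proof -
  note d = otri_distinct[OF a(1)] and d' = otri_distinct[OF b(1)]
    and l = otri_less[OF a(1)] and l' = otri_less[OF b(1)]
  have sup: "i \<in> {x, y, z}" "i \<in> {x', y', z'}" if "pt u x i > 0" for i
  proof -
    show "i \<in> {x, y, z}" using that a(2) by (auto simp: wgt_def pt_apply split: if_splits)
    show "i \<in> {x', y', z'}" using that b(2) unfolding v by (auto simp: wgt_def pt_apply split: if_splits)
  qed
  have pos: "u i > 0 \<Longrightarrow> pt u x i > 0" "u' i > 0 \<Longrightarrow> pt u x i > 0" for i
    by (simp add: pt_apply) (simp add: v pt_apply)
  have ccw: "ccw x y z" "ccw x' y' z'" using a(1) b(1) by (auto simp: otri_def)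
  have "pt u x x > 0" "pt u x x' > 0" by (simp add: pt_apply) (simp add: v pt_apply)
  then have in1: "x \<in> {x', y', z'}" "x' \<in> {x, y, z}" using sup by blast+
  consider "x' = x" | "x' = y" | "x' = z" using in1(2) by blast
  then show ?thesis
  proof cases
    case 1
    \<comment> \<open>Two distinct arrows cannot take the unit from the same vertex: the triangles
      would be equal with opposite orientations, or a vertex would lie behind a polygon
      edge.\<close>
    have "u = u'" using v 1 pt_inj by metis
    then have yy: "y \<noteq> y'" using neq 1 by auto
    have zz: "z \<noteq> z'" using yy otri_third[OF otri_rot'[OF a(1)]] otri_rot'[OF b(1)] 1 by metis
    have zy: "z' \<noteq> y \<or> z \<noteq> y'" using ccw 1 ccw_asym by metis
    consider "u z > 0" | "y = nxt x" "u z = 0" using a(3) by (auto simp: kept_def)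
    then show ?thesis
    proof cases
      assume "u z > 0"
      then have "z = y'" using sup(2) pos zz d 1 by blast
      moreover have "y' \<noteq> nxt x" using not_ccw_nxt[of y x] ccw(1) l \<open>z = y'\<close> by metis
      then have "u' z' > 0" using b(3) 1 by (simp add: kept_def)
      then have "z' = y" using sup(1) pos zz d' 1 by blast
      ultimately show ?thesis using zy by blast
    next
      assume y: "y = nxt x" "u z = 0"
      then have "u' z' > 0" using b(3) 1 yy by (simp add: kept_def)
      then have "z' = y" using sup(1) pos zz d' 1 by blast
      then show ?thesis using ccw(2) 1 y(1) not_ccw_nxt l' by metis
    qed
  next
    case 2
    show ?thesis
    proof (cases "x = z'")
      case True
      then show ?thesis using otri_third[OF a(1)] otri_rot'[OF b(1)] 2 by metis
    next
      case False
      then have y': "y' = x" using in1(1) 2 d by blast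
      have "y' \<noteq> nxt x'" using not_ccw_nxt[of z y] ccw_rot[OF ccw(1)] l 2 y' by metis
      then have "u' z' > 0" using b(3) by (simp add: kept_def)
      then have "z' = z" using sup(1) pos d' 2 y' by blast
      then show ?thesis using otri_not_swap[OF a(1)] b(1) 2 y' by blast
    qed
  next
    case 3
    show ?thesis
    proof (cases "y' = x")
      case True
      then show ?thesis using 3 by blast
    next
      case False
      then have z': "z' = x" using in1(1) 3 d by blast
      have "y \<noteq> y'" using otri_not_swap[OF otri_rot'[OF a(1)]] otri_rot'[OF b(1)] 3 z' by metis
      then have "\<not> u y > 0" "\<not> u' y' > 0" using sup pos d d' 3 z' by blast+
      then show ?thesis using 3 z' by simp
    qed
  qed
qed

lemma arcdeg_le: "i < n \<Longrightarrow> arcdeg n x y i \<le> D \<Longrightarrow> inarc x y i \<Longrightarrow> D > 0"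
  by (simp add: arcdeg_def)

lemma joinable_arrows:
  assumes ab: "a \<in> glAr m n T" "b \<in> glAr m n T" "fst a = v" "fst b = v" "a \<noteq> b"
    and w: "w \<in> glV m n T" and fl: "flow v D w"
    and D: "\<And>i. arrow_deg n a i \<le> D i" "\<And>i. arrow_deg n b i \<le> D i"
  shows "joinable v D w a b"
proof -
  obtain u x y z where a: "otri x y z" "wgt (m - 1) u x y z" "kept u x y z" "a = ar u x y"
    using ab(1) glAr_iff by blast
  obtain u' x' y' z' where b: "otri x' y' z'" "wgt (m - 1) u' x' y' z'" "kept u' x' y' z'" "b = ar u' x' y'"
    using ab(2) glAr_iff by blast
  have v: "pt u x = v" "pt u' x' = v" using ab(3,4) a(4) b(4) by simp_all
  note d = otri_distinct[OF a(1)] and d' = otri_distinct[OF b(1)]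
    and l = otri_less[OF a(1)] and l' = otri_less[OF b(1)]
  have Da: "D i > 0" if "i < n" "inarc x y i" for i
    using D(1)[of i] a(4) arrow_deg_ar[of x y n u] d that arcdeg_le by metis
  have Db: "D i > 0" if "i < n" "inarc x' y' i" for i
    using D(2)[of i] b(4) arrow_deg_ar[of x' y' n u'] d' that arcdeg_le by metis
  consider (succ) "x' = y" "y' = z" | (pred) "x' = z" "y' = x" | (across) "x' = z" "z' = x" "u y = 0" "u' y' = 0"
    using arrows_at_vertex[OF a(1-3) b(1-3)] v ab(5) a(4) b(4) by auto
  then show ?thesis
  proof cases
    case succ
    then show ?thesis
      using joinable_same[OF a(1-3) v(1) _ w fl, of u'] v(2) Da Db a(4) b(4) by blast
  next
    case pred
    have "otri z x z'" using b(1) pred by simp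
    then have "z' = y" using otri_third otri_rot'[OF a(1)] by blast
    then have "joinable v D w b a"
      using joinable_same[OF b(1-3) v(2) _ w fl, of u] v(1) Da Db a(4) b(4) pred by blast
    then show ?thesis by (rule joinable_sym)
  next
    case across
    obtain p q r where pqr: "otri p q r" "wgt m w p q r" using w glV_iff by blast
    have w0: "w j = 0" if "j \<notin> {p, q, r}" for j using pqr(2) that by (auto simp: wgt_def)
    have b1: "otri z y' x" using b(1) across by simp
    \<comment> \<open>The triangle of \<open>w\<close> lies on one side of \<open>x z\<close>. Flow
      leaving the end whose outgoing arc avoids that side's interior reaches the other end
      unabsorbed, so \<open>D\<close> has room for the whole arc.\<close>
    show ?thesis
    proof (cases "{p, q, r} \<subseteq> carc z x")
      case True
      have "w j = 0" if "ccw x j z" for j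
        using True ccw_not_carc[OF ccw_rot[OF ccw_rot[OF that]]] w0[of j] by blast
      then have "D i > 0" if "i < n" "inarc x z i" for i
        using flow_mono[OF fl _ _ that] l Da[of x] by fastforce
      then show ?thesis
        using joinable_across[OF a(1) b1 a(2) across(3) v(1) _ w fl, of u'] v(2) Db a(4) b(4) across by blast
    next
      case False
      have "carc x y \<subseteq> carc x z" "carc y z \<subseteq> carc x z" "{x, y, z} \<subseteq> carc x z"
        using a(1) by (auto simp: otri_def carc_def ccw_def)
      then have *: "{p, q, r} \<subseteq> carc x z" using False otri_position[OF a(1) pqr(1)] by blast
      have "w j = 0" if "ccw z j x" for j
        using * ccw_not_carc[OF ccw_rot[OF ccw_rot[OF that]]] w0[of j] by blast
      then have "D i > 0" if "i < n" "inarc z x i" for i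
        using flow_mono[OF fl _ _ that] l Db[of z] across by fastforce
      then have "joinable v D w b a"
        using joinable_across[of z y' x y u' v u w D] b1 a(1) across(4) w fl v(1) b(2) v(2) Da a(4) b(4) across by blast
      then show ?thesis by (rule joinable_sym)
    qed
  qed
qed

lemma sum_arrow_deg_pos:
  assumes "a \<in> glAr m n T" shows "(\<Sum>i<n. arrow_deg n a i) > 0"
proof -
  obtain u x y z where a: "otri x y z" "a = ar u x y" using assms glAr_iff by blast
  then have "arrow_deg n a x = 1" "x < n" using otri_less[OF a(1)] otri_distinct[OF a(1)] arrow_deg_ar_pos by auto
  then show ?thesis by (metis finite_lessThan lessThan_iff sum_pos2 zero_le zero_less_one)
qed

text \<open>Induction on the total degree. Different first arrows \<open>a\<close> and
  \<open>b\<close> are completed to congruent paths \<open>a # R\<close> and \<open>b # S\<close>;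
  after a common first arrow the tails have smaller degree, so the induction links \<open>P\<close>
  to \<open>a # R\<close> and \<open>b # S\<close> to \<open>Q\<close>.\<close>

lemma paths_path_cong:
  "path_between v P w \<Longrightarrow> path_between v Q w \<Longrightarrow> degl (arrow_deg n) P = degl (arrow_deg n) Q \<Longrightarrow> path_cong v P Q"
proof (induction "\<Sum>i<n. degl (arrow_deg n) P i" arbitrary: v P Q rule: less_induct)
  case less
  have sum_Cons: "(\<Sum>i<n. degl (arrow_deg n) (a # R) i) = (\<Sum>i<n. arrow_deg n a i) + (\<Sum>i<n. degl (arrow_deg n) R i)" for a R
    by (simp add: sum.distrib)
  show ?case
  proof (cases "P = [] \<or> Q = []")
    case True
    then have "degl (arrow_deg n) P = (\<lambda>i. 0)" using less(4) by (auto simp: degl_def)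
    then have zero: "(\<Sum>i<n. degl (arrow_deg n) P i) = 0" "(\<Sum>i<n. degl (arrow_deg n) Q i) = 0" using less(4) by simp_all
    have "R = []" if "path_between v R w" "(\<Sum>i<n. degl (arrow_deg n) R i) = 0" for R
    proof (cases R)
      case (Cons a R')
      then have "a \<in> glAr m n T" using that(1) by (simp add: path_between_Cons)
      then show ?thesis using sum_arrow_deg_pos[of a] that(2) unfolding Cons sum_Cons by simp
    qed
    then have "P = []" "Q = []" using less(2,3) zero by blast+
    then show ?thesis by (simp add: path_cong_refl)
  next
    case False
    then obtain a P' b Q' where PQ: "P = a # P'" "Q = b # Q'" by (meson neq_Nil_conv)
    have a: "a \<in> glAr m n T" "fst a = v" "path_between (snd a) P' w" and b: "b \<in> glAr m n T" "fst b = v" "path_between (snd b) Q' w"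
      using less(2,3) PQ by (auto simp: path_between_Cons)
    have deg: "degl (arrow_deg n) (a # P') = degl (arrow_deg n) (b # Q')" using less(4) PQ by simp
    have tl: "path_cong v (c # R) (c # S)"
      if "c \<in> glAr m n T" "fst c = v" "path_between (snd c) R w" "path_between (snd c) S w"
        "degl (arrow_deg n) (c # R) = degl (arrow_deg n) (c # S)" "degl (arrow_deg n) (c # R) = degl (arrow_deg n) P" for c R S
    proof -
      have "degl (arrow_deg n) R = degl (arrow_deg n) S" using that(5) by (auto simp: fun_eq_iff)
      moreover have "(\<Sum>i<n. degl (arrow_deg n) R i) < (\<Sum>i<n. degl (arrow_deg n) P i)"
        using sum_Cons[of c R] sum_arrow_deg_pos[OF that(1)] unfolding that(6) by simp
      ultimately have "path_cong (snd c) R S" using less(1) that by blast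
      then show ?thesis using path_cong_Cons that(1,2) by blast
    qed
    show ?thesis
    proof (cases "a = b")
      case True
      then show ?thesis using tl[of a P' Q'] a b deg PQ by simp
    next
      case False
      have "arrow_deg n a i \<le> degl (arrow_deg n) P i" "arrow_deg n b i \<le> degl (arrow_deg n) P i" for i
        using less(4) PQ by (simp_all add: fun_eq_iff) (metis le_add1)
      then have "joinable v (degl (arrow_deg n) P) w a b"
        using joinable_arrows[OF a(1) b(1) a(2) b(2) False path_between_end[OF less(2)] path_between_flow[OF less(2)]] by blast
      then obtain R S where RS: "path_between v (a # R) w" "path_between v (b # S) w"
        "\<forall>i<n. degl (arrow_deg n) (a # R) i = degl (arrow_deg n) P i"
        "\<forall>i<n. degl (arrow_deg n) (b # S) i = degl (arrow_deg n) P i" "path_cong v (a # R) (b # S)"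
        unfolding joinable_def by blast
      have e: "degl (arrow_deg n) (a # R) = degl (arrow_deg n) P"
        by (rule degl_arrow_deg_eqI) (rule RS(3)[rule_format])
      have e': "degl (arrow_deg n) (b # S) = degl (arrow_deg n) P"
        by (rule degl_arrow_deg_eqI) (rule RS(4)[rule_format])
      have "path_cong v (a # P') (a # R)" 
      proof (rule tl)
        show "path_between (snd a) R w" using RS(1) by (simp add: path_between_Cons)
        show "degl (arrow_deg n) (a # P') = degl (arrow_deg n) (a # R)" by (simp only: e PQ(1))
      qed (use a in \<open>simp_all add: PQ(1)\<close>)
      moreover have "path_cong v (b # S) (b # Q')" 
      proof (rule tl)
        show "path_between (snd b) S w" using RS(2) by (simp add: path_between_Cons)
        show "degl (arrow_deg n) (b # S) = degl (arrow_deg n) (b # Q')" by (simp only: e' less(4) PQ(2))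
      qed (use b e' in simp_all)
      ultimately show ?thesis using path_cong_trans RS(5) PQ by blast
    qed
  qed
qed

section \<open>Boundary vertices and comparison of triangulations\<close>

lemma boundary_arrow_iff:
  "a \<in> glAr m n T - glInt m n T \<longleftrightarrow>
    (\<exists>x u. x < n \<and> (\<forall>i. i \<noteq> x \<and> i \<noteq> nxt x \<longrightarrow> u i = 0) \<and> u x + u (nxt x) = m - 1 \<and> a = ar u x (nxt x))"
proof
  assume a: "a \<in> glAr m n T - glInt m n T"
  then obtain u x y z where xyz: "otri x y z" "wgt (m - 1) u x y z" "kept u x y z" "a = ar u x y"
    using glAr_iff by blast
  \<comment> \<open>Mass at \<open>z\<close> would put a downward triangle on the other side of the
    arrow and make it internal.\<close>
  have "u z = 0"
  proof (rule ccontr)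
    assume "u z \<noteq> 0"
    then have "a \<in> glInt m n T" unfolding glInt_iff using xyz
      by (intro exI[of _ u] exI[of _ x] exI[of _ y] exI[of _ z]) simp
    then show False using a by simp
  qed
  then have y: "y = nxt x" using xyz(3) by (simp add: kept_def)
  have "u i = 0" if "i \<noteq> x \<and> i \<noteq> nxt x" for i
    using that xyz(2) y \<open>u z = 0\<close> by (cases "i = z") (auto simp: wgt_def)
  moreover have "u x + u (nxt x) = m - 1" using xyz(2) \<open>u z = 0\<close> y by (simp add: wgt_def)
  ultimately show "\<exists>x u. x < n \<and> (\<forall>i. i \<noteq> x \<and> i \<noteq> nxt x \<longrightarrow> u i = 0) \<and> u x + u (nxt x) = m - 1 \<and> a = ar u x (nxt x)"
    using xyz y otri_less[OF xyz(1)] by blast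
next
  assume "\<exists>x u. x < n \<and> (\<forall>i. i \<noteq> x \<and> i \<noteq> nxt x \<longrightarrow> u i = 0) \<and> u x + u (nxt x) = m - 1 \<and> a = ar u x (nxt x)"
  then obtain x u where x: "x < n" "\<forall>i. i \<noteq> x \<and> i \<noteq> nxt x \<longrightarrow> u i = 0" "u x + u (nxt x) = m - 1" "a = ar u x (nxt x)"
    by blast
  obtain z where z: "otri x (nxt x) z" using otri_ex_edge[OF x(1)] by blast
  note d = otri_distinct[OF z]
  have uz: "u z = 0" using x(2) d by blast
  have "wgt (m - 1) u x (nxt x) z" using x(2,3) uz by (simp add: wgt_def)
  then have "a \<in> glAr m n T" using z x(4) glAr_iff kept_def by blast
  moreover have "a \<notin> glInt m n T"
  proof
    assume "a \<in> glInt m n T"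
    then obtain u1 x1 y1 z1 where h: "otri x1 y1 z1" "u1 z1 > 0" "ar u x (nxt x) = ar u1 x1 y1"
      using glInt_iff x(4) by blast
    have "u = u1 \<and> x = x1 \<and> nxt x = y1" using ar_inj[OF h(3)] d otri_distinct[OF h(1)] by blast
    then show False using h(1,2) otri_third[OF z, of z1] uz by auto
  qed
  ultimately show "a \<in> glAr m n T - glInt m n T" by blast
qed

text \<open>The right-hand side depends on \<open>n\<close> and \<open>m\<close> alone, which
  identifies the boundary vertices of different triangulations.\<close>

lemma glB_eq:
  "glB m n T = {v. \<exists>x u. x < n \<and> (\<forall>i. i \<noteq> x \<and> i \<noteq> nxt x \<longrightarrow> u i = 0) \<and> u x + u (nxt x) = m - 1
      \<and> (v = pt u x \<or> v = pt u (nxt x))}"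
proof -
  let ?P = "\<lambda>x u. x < n \<and> (\<forall>i. i \<noteq> x \<and> i \<noteq> nxt x \<longrightarrow> u i = 0) \<and> u x + u (nxt x) = m - 1"
  have "(\<exists>a. (\<exists>x u. ?P x u \<and> a = ar u x (nxt x)) \<and> (fst a = v \<or> snd a = v))
      \<longleftrightarrow> (\<exists>x u. ?P x u \<and> (v = pt u x \<or> v = pt u (nxt x)))" (is "?L \<longleftrightarrow> ?R") for v
  proof
    assume ?L
    then obtain a x u where "?P x u" "a = ar u x (nxt x)" "fst a = v \<or> snd a = v" by blast
    then show ?R by (intro exI[of _ x] exI[of _ u]) auto
  next
    assume ?R
    then obtain x u where "?P x u" "v = pt u x \<or> v = pt u (nxt x)" by blast
    then show ?L by (intro exI[of _ "ar u x (nxt x)"] conjI exI[of _ x] exI[of _ u]) auto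
  qed
  then show ?thesis unfolding glB_def Bex_def boundary_arrow_iff by (simp only: conj_assoc)
qed

lemma glB_subset: "glB m n T \<subseteq> glV m n T"
  unfolding glB_def using arrow_in_glV by auto

lemma valid_path_cong:
  assumes "valid_path (glV m n T) (glAr m n T) p" "valid_path (glV m n T) (glAr m n T) q"
    and "pkey (arrow_deg n) p = pkey (arrow_deg n) q"
  shows "pcong (glV m n T) (glAr m n T) (glR m n T) p q"
  using paths_path_cong[of "fst p" "snd p" "pend p" "snd q"] assms
  by (cases p; cases q) (auto simp: path_between_def path_cong_def pkey_def pend_def)

lemma valid_path_ex:
  assumes "fst k \<in> glV m n T" "fst (snd k) \<in> glV m n T" "flow (fst k) (snd (snd k)) (fst (snd k))"
    and "\<And>i. i \<ge> n \<Longrightarrow> snd (snd k) i = 0"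
  shows "\<exists>q. valid_path (glV m n T) (glAr m n T) q \<and> pkey (arrow_deg n) q = k"
proof -
  obtain P where P: "path_between (fst k) P (fst (snd k))" "\<forall>i<n. degl (arrow_deg n) P i = snd (snd k) i"
    using path_ex[OF assms(2,1,3)] by blast
  have "degl (arrow_deg n) P = snd (snd k)"
    using P(2) assms(4) degl_arrow_deg_ge by (metis ext not_le)
  then show ?thesis using P(1)
    by (intro exI[of _ "(fst k, P)"]) (auto simp: path_between_def pkey_def pend_def prod_eq_iff)
qed

lemma valid_path_flow:
  "valid_path (glV m n T) (glAr m n T) p \<Longrightarrow> flow (fst p) (degl (arrow_deg n) (snd p)) (pend p)"
  using flow_path[of "fst p" "snd p"] by (auto simp: valid_path_def pend_def)

end

text \<open>The path is forgotten except for its ends and its transport plan; for \<open>T'\<close>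
  these suffice to construct a path with the same key.\<close>

lemma boundary_path_transfer:
  assumes T: "gl_dimer n T m" "gl_dimer n T' m" and p: "valid_path (glV m n T) (glAr m n T) p"
    and B: "fst p \<in> glB m n T'" "pend p \<in> glB m n T'"
  shows "\<exists>q. valid_path (glV m n T') (glAr m n T') q \<and> pkey (arrow_deg n) q = pkey (arrow_deg n) p"
proof -
  interpret A: gl_dimer n T m by (fact T(1))
  interpret A': gl_dimer n T' m by (fact T(2))
  show ?thesis
    using A'.glB_subset B A.valid_path_flow[OF p] degl_arrow_deg_ge
    by (intro A'.valid_path_ex) (auto simp: pkey_def)
qed

theorem theorem4p8:
  fixes m n :: nat and T T' :: "(nat \<times> nat) set"
  assumes "m \<ge> 2" and "n \<ge> 3"
    and "triangulation n T" and "fan n T"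
    and "triangulation n T'"
  shows "gl_boundary_algs_iso m n T T'"
proof -
  interpret A: gl_dimer n T m using assms by unfold_locales
  interpret A': gl_dimer n T' m using assms by unfold_locales
  have B: "glB m n T' = glB m n T" unfolding A.glB_eq A'.glB_eq ..
  show ?thesis
    unfolding gl_boundary_algs_iso_def B
  proof (rule corner_alg_isoI[where d = "arrow_deg n"])
    fix p assume "valid_path (glV m n T) (glAr m n T) p" "fst p \<in> glB m n T" "pend p \<in> glB m n T"
    then show "\<exists>q. valid_path (glV m n T') (glAr m n T') q \<and> pkey (arrow_deg n) q = pkey (arrow_deg n) p"
      by (intro boundary_path_transfer[OF A.gl_dimer_axioms A'.gl_dimer_axioms]) (simp_all add: B)
  next
    fix p assume "valid_path (glV m n T') (glAr m n T') p" "fst p \<in> glB m n T" "pend p \<in> glB m n T"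
    then show "\<exists>q. valid_path (glV m n T) (glAr m n T) q \<and> pkey (arrow_deg n) q = pkey (arrow_deg n) p"
      by (rule boundary_path_transfer[OF A'.gl_dimer_axioms A.gl_dimer_axioms])
  qed (fact A.glR_key A'.glR_key | erule (1) A.valid_path_cong, assumption | erule (1) A'.valid_path_cong, assumption)+
qed

end
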